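(* $R_{(7,7)} \leq 0.0408975$, $R_{(8,8)} \leq 0.0188887$, $R_{(9,8)} \leq 0.0561537$, $R_{(10,9)} \leq 0.0277279$, and $R_{(11,10)} \leq 0.0132033$.
   Context: For integers $b \geq k$ and $n$, a $(b,k)$-hash code of length $n$ is a subset $\mathcal{C} \subseteq \{1,2,\ldots,b\}^n$ such that for any $k$ distinct elements of $\mathcal{C}$ there is a coordinate $i \in \{1,\ldots,n\}$ in which their $i$-th entries are pairwise distinct. Let $N_{(b,k)}(n)$ denote the maximum size of a $(b,k)$-hash code of length $n$, and define $R_{(b,k)} = \limsup_{n\to\infty} \frac{1}{n}\log_2 N_{(b,k)}(n)$. *)

theory Defs
  imports "HOL-Analysis.Analysis"
begin

definition words :: "nat \<Rightarrow> nat \<Rightarrow> (nat \<Rightarrow> nat) set" where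
  "words b n = PiE {0..<n} (\<lambda>_. {1..b})"

definition is_hash_code :: "nat \<Rightarrow> nat \<Rightarrow> nat \<Rightarrow> (nat \<Rightarrow> nat) set \<Rightarrow> bool" where
  "is_hash_code b k n C \<longleftrightarrow> C \<subseteq> words b n \<and>
     (\<forall>S \<subseteq> C. card S = k \<longrightarrow> (\<exists>i \<in> {0..<n}. inj_on (\<lambda>c. c i) S))"

definition N_hash :: "nat \<Rightarrow> nat \<Rightarrow> nat \<Rightarrow> nat" where
  "N_hash b k n = Max {card C | C. is_hash_code b k n C}"

definition R_hash :: "nat \<Rightarrow> nat \<Rightarrow> ereal" where
  "R_hash b k = limsup (\<lambda>n. ereal (log 2 (real (N_hash b k n)) / real n))"

end

theory Submission
  imports Defs
begin

text \<open>
  Put \<open>m = k - 2\<close>. Fixing \<open>m\<close> words of a code, Hansel's lemma bounds the logarithm of the code size,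
  up to the factor \<open>ln (b - m)\<close>, by the average number of coordinates at which a further word and the
  \<open>m\<close> fixed words are all distinct.
  The fixed words are drawn from a random subcode using only \<open>m - 1\<close> symbols in each of the first \<open>l\<close>
  coordinates, so these coordinates contribute nothing; \<open>l\<close> is as large as the code size permits, about
  \<open>log 2 (card C) / log 2 (b / (m - 1))\<close>. Every other coordinate contributes on average a quadratic form
  in the symbol distributions of the subcodes. This form is at most its value \<open>F\<close> at the uniform
  distribution, because \<open>phi p q + phi q p + 2 * F * (p \<bullet> q) \<le> 2 * F * (1 + 1 / b)\<close> for all distributions
  \<open>p\<close>, \<open>q\<close>: at a maximizer without zeros both are uniform, and if there are zeros then bounds of Maclaurin type
  reduce the claim to finitely many numerical comparisons.
\<close>

section \<open>Elementary symmetric polynomials\<close>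

text \<open>Without the inner product the pairwise claim is false: if \<open>q\<close> is a point
  mass and \<open>p\<close> is uniform on the other symbols, then \<open>phi m I q p\<close>
  vanishes, while \<open>phi m I p q = fall m (b - 1)\<close> exceeds \<open>2 * F\<close> in all
  five cases. The correction is free because the subcode distributions average to the distribution
  \<open>g\<close> of the whole code: the mean of their pairwise inner products is the sum of the
  squares of \<open>g\<close>, which is at least \<open>1 / b\<close>, exactly the surplus allowed
  on the right. Subcodes use \<open>m - 1\<close> symbols by the pigeonhole principle:
  \<open>m\<close> words cannot then be distinct at such a coordinate. Fixing these symbols keeps on
  average a share \<open>((m - 1) / b) ^ l\<close> of the words, and the subcodes must stay large,
  since otherwise \<open>m\<close> independent draws would often repeat a word; this limits
  \<open>l\<close>. For a code of rate \<open>t\<close> the argument closes to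
  \<open>t \<le> M * (1 - t / \<Lambda>)\<close> with \<open>M = log 2 (b - m) * F\<close> and
  \<open>\<Lambda> = log 2 (b / (m - 1))\<close>. The five constants lie slightly above the
  solutions of this inequality.\<close>

definition esym :: "nat \<Rightarrow> 'a set \<Rightarrow> ('a \<Rightarrow> real) \<Rightarrow> real" where
  "esym m J p = (\<Sum>T | T \<subseteq> J \<and> card T = m. \<Prod>t\<in>T. p t)"

lemma esym_0 [simp]: "finite J \<Longrightarrow> esym 0 J p = 1"
proof -
  assume "finite J"
  then have "{T. T \<subseteq> J \<and> card T = 0} = {{}}"
    by (auto dest: finite_subset)
  then show ?thesis by (simp add: esym_def)
qed

lemma esym_insert:
  assumes "finite J" "i \<notin> J"
  shows "esym (Suc m) (insert i J) p = esym (Suc m) J p + p i * esym m J p"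
proof -
  have inj: "inj_on (insert i) {T. T \<subseteq> J \<and> card T = m}"
    using assms(2) by (auto simp: inj_on_def)
  have eq: "{T. T \<subseteq> insert i J \<and> card T = Suc m} =
      {T. T \<subseteq> J \<and> card T = Suc m} \<union> insert i ` {T. T \<subseteq> J \<and> card T = m}"
  proof (intro equalityI subsetI)
    fix T assume T: "T \<in> {T. T \<subseteq> insert i J \<and> card T = Suc m}"
    show "T \<in> {T. T \<subseteq> J \<and> card T = Suc m} \<union> insert i ` {T. T \<subseteq> J \<and> card T = m}"
    proof (cases "i \<in> T")
      case True
      then have "T = insert i (T - {i})" "T - {i} \<subseteq> J" "card (T - {i}) = m"
        using T by auto
      then show ?thesis by blast
    qed (use T in auto)
  next
    fix T assume "T \<in> {T. T \<subseteq> J \<and> card T = Suc m} \<union> insert i ` {T. T \<subseteq> J \<and> card T = m}"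
    then show "T \<in> {T. T \<subseteq> insert i J \<and> card T = Suc m}"
      using assms finite_subset[OF _ assms(1)] by (auto simp: card_insert_if)
  qed
  have "esym (Suc m) (insert i J) p =
      esym (Suc m) J p + (\<Sum>T\<in>insert i ` {T. T \<subseteq> J \<and> card T = m}. \<Prod>t\<in>T. p t)"
    unfolding esym_def eq using assms by (subst sum.union_disjoint) auto
  also have "(\<Sum>T\<in>insert i ` {T. T \<subseteq> J \<and> card T = m}. \<Prod>t\<in>T. p t) =
      (\<Sum>T | T \<subseteq> J \<and> card T = m. p i * (\<Prod>t\<in>T. p t))"
    using inj
  proof (subst sum.reindex, simp, intro sum.cong refl)
    fix T assume "T \<in> {T. T \<subseteq> J \<and> card T = m}"
    then have "finite T" "i \<notin> T" using assms finite_subset by auto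
    then show "((\<lambda>T. \<Prod>t\<in>T. p t) \<circ> insert i) T = p i * (\<Prod>t\<in>T. p t)" by simp
  qed
  finally show ?thesis by (simp add: esym_def sum_distrib_left)
qed

lemma esym_nonneg: "(\<And>t. t \<in> J \<Longrightarrow> 0 \<le> p t) \<Longrightarrow> 0 \<le> esym m J p"
  unfolding esym_def by (intro sum_nonneg prod_nonneg) auto

lemma esym_cong: "(\<And>t. t \<in> J \<Longrightarrow> p t = q t) \<Longrightarrow> esym m J p = esym m J q"
  unfolding esym_def by (intro sum.cong prod.cong) auto

lemma esym_subset:
  assumes "finite J" "K \<subseteq> J" "\<And>t. t \<in> J - K \<Longrightarrow> p t = 0"
  shows "esym m J p = esym m K p"
  unfolding esym_def
proof (rule sum.mono_neutral_right)
  show "finite {T. T \<subseteq> J \<and> card T = m}" using assms(1) by simp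
  show "\<forall>T\<in>{T. T \<subseteq> J \<and> card T = m} - {T. T \<subseteq> K \<and> card T = m}. (\<Prod>t\<in>T. p t) = 0"
  proof
    fix T assume "T \<in> {T. T \<subseteq> J \<and> card T = m} - {T. T \<subseteq> K \<and> card T = m}"
    then have "finite T" "\<exists>t\<in>T. p t = 0" using assms finite_subset by blast+
    then show "(\<Prod>t\<in>T. p t) = 0" by (auto simp: prod_zero)
  qed
qed (use assms in auto)

lemma esym_mono_set:
  assumes "finite J" "K \<subseteq> J" "\<And>t. t \<in> J \<Longrightarrow> 0 \<le> p t"
  shows "esym m K p \<le> esym m J p"
  unfolding esym_def using assms by (intro sum_mono2 prod_nonneg) auto

lemma esym_eq_0: "finite J \<Longrightarrow> card J < m \<Longrightarrow> esym m J p = 0"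
proof -
  assume "finite J" "card J < m"
  then have "{T. T \<subseteq> J \<and> card T = m} = {}"
    by (metis (mono_tags, lifting) Collect_empty_eq card_mono leD)
  then show ?thesis by (simp only: esym_def sum.empty)
qed

lemma esym_mult: "esym m J (\<lambda>t. c * p t) = c ^ m * esym m J p"
  unfolding esym_def sum_distrib_left by (intro sum.cong) (auto simp: prod.distrib)

text \<open>Weighted AM-GM, normalised to mean at most 1; it follows from
  \<open>z \<le> exp (z - 1)\<close>.\<close>

lemma power_mult_le_1:
  fixes x y :: real
  assumes "0 \<le> x" "0 \<le> y" "real u * x + real v * y \<le> real u + real v"
  shows "x ^ u * y ^ v \<le> 1"
proof -
  have le: "z \<le> exp (z - 1)" for z :: real using exp_ge_add_one_self[of "z - 1"] by simp
  have "x ^ u * y ^ v \<le> exp (x - 1) ^ u * exp (y - 1) ^ v"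
    using assms by (intro mult_mono power_mono le) auto
  also have "\<dots> = exp (real u * (x - 1) + real v * (y - 1))"
    by (simp add: exp_add exp_of_nat_mult)
  also have "\<dots> \<le> 1" using assms(3) by (simp add: algebra_simps)
  finally show ?thesis .
qed

lemma power_mult_le_power_mean:
  fixes y z :: real
  assumes "0 \<le> y" "0 \<le> z"
  shows "y ^ m * z \<le> ((real m * y + z) / real (Suc m)) ^ Suc m"
proof (cases "real m * y + z = 0")
  case True
  then have "real m * y = 0" "z = 0" using assms by (auto simp: add_nonneg_eq_0_iff)
  then show ?thesis using assms by simp
next
  case False
  define s where "s = (real m * y + z) / real (Suc m)"
  have "real m * y + z > 0" using False assms by (simp add: order_less_le)
  then have s: "s > 0" by (simp add: s_def)
  have "real m * (y / s) + real 1 * (z / s) = (real m * y + z) / s"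
    by (simp add: add_divide_distrib)
  also have "\<dots> = real (Suc m)" using False by (simp add: s_def)
  finally have "(y / s) ^ m * (z / s) ^ 1 \<le> 1"
    using assms s by (intro power_mult_le_1) auto
  then have "y ^ m * z \<le> s ^ m * s"
    using s by (simp add: power_divide field_simps)
  then show ?thesis by (simp add: s_def mult.commute)
qed

text \<open>Maclaurin's inequality, by adding one variable \<open>x\<close> to \<open>n\<close>
  variables of mean \<open>y\<close>. The induction hypothesis gives a multiple of
  \<open>y ^ l * (a * y + (1 - a) * x)\<close>. AM-GM applies to \<open>l\<close> copies of
  \<open>y\<close> and this one convex combination, whose common mean is exactly the mean of all
  \<open>n + 1\<close> variables.\<close>

lemma esym_maclaurin:
  assumes "finite J" "\<And>t. t \<in> J \<Longrightarrow> 0 \<le> p t"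
  shows "esym m J p \<le> real (card J choose m) * (sum p J / real (card J)) ^ m"
  using assms
proof (induction J arbitrary: m rule: finite_induct)
  case empty
  then show ?case by (cases m) (auto simp: esym_eq_0)
next
  case (insert i J)
  show ?case
  proof (cases m)
    case 0
    then show ?thesis using insert by simp
  next
    case (Suc l)
    define n where "n = card J"
    define y where "y = sum p J / real n"
    define x where "x = p i"
    have y: "0 \<le> y" and x: "0 \<le> x" using insert.prems by (auto simp: y_def x_def sum_nonneg)
    have ny: "real n * y = sum p J"
      using insert.hyps by (cases "n = 0") (auto simp: y_def n_def)
    consider "n < l" | "l \<le> n" by linarith
    then show ?thesis
    proof cases
      case 1
      then have "esym m (insert i J) p = 0"
        using insert.hyps Suc by (intro esym_eq_0) (auto simp: n_def)
      then show ?thesis using insert.prems by (auto intro!: mult_nonneg_nonneg zero_le_power divide_nonneg_nonneg sum_nonneg simp del: sum.insert)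
    next
      case 2
      \<comment> \<open>The proportion of the \<open>Suc l\<close>-subsets of
        \<open>insert i J\<close> that avoid \<open>i\<close>.\<close>
      define a where "a = real (Suc n - Suc l) / real (Suc n)"
      have a: "0 \<le> a" "a \<le> 1" by (auto simp: a_def)
      have a': "1 - a = real (Suc l) / real (Suc n)"
        using 2 by (simp add: a_def of_nat_diff divide_simps)
      define Z where "Z = real (Suc n choose Suc l)"
      have ch: "real (n choose Suc l) = Z * a" "real (n choose l) = Z * (1 - a)"
      proof -
        have "Z * real (Suc l) = real (Suc n) * real (n choose l)"
          unfolding Z_def using Suc_times_binomial_eq[of n l] by (metis mult.commute of_nat_mult)
        then show *: "real (n choose l) = Z * (1 - a)"
          unfolding a' by (simp add: field_simps del: of_nat_Suc)
        have "Z = real (n choose l) + real (n choose Suc l)" by (simp add: Z_def)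
        then show "real (n choose Suc l) = Z * a"
          unfolding * by (simp add: algebra_simps)
      qed
      have "esym m (insert i J) p = esym (Suc l) J p + x * esym l J p"
        using insert.hyps Suc by (simp add: esym_insert x_def)
      also have "\<dots> \<le> real (n choose Suc l) * y ^ Suc l + x * (real (n choose l) * y ^ l)"
        using insert.IH[of "Suc l"] insert.IH[of l] insert.prems x
        by (intro add_mono mult_left_mono) (auto simp: n_def y_def)
      also have "\<dots> = Z * (y ^ l * (a * y + (1 - a) * x))"
        by (simp add: ch algebra_simps)
      also have "\<dots> \<le> Z *
          ((real l * y + (a * y + (1 - a) * x)) / real (Suc l)) ^ Suc l"
        using a x y by (intro mult_left_mono power_mult_le_power_mean) (auto simp: Z_def)
      also have "(real l * y + (a * y + (1 - a) * x)) / real (Suc l) = (real n * y + x) / real (Suc n)"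
      proof -
        have *: "(L * y + L / N * (x - y)) / L = (N * y + (x - y)) / N" if "L > 0" "N > 0" for L N :: real
          using that by (simp add: field_simps)
        have "real l * y + (a * y + (1 - a) * x) = real (Suc l) * y + (1 - a) * (x - y)"
          by (simp add: algebra_simps)
        also have "\<dots> / real (Suc l) = (real (Suc n) * y + (x - y)) / real (Suc n)"
          unfolding a' by (rule *) auto
        also have "real (Suc n) * y + (x - y) = real n * y + x"
          by (simp add: algebra_simps)
        finally show ?thesis .
      qed
      also have "\<dots> = sum p (insert i J) / real (card (insert i J))"
        using insert.hyps ny by (simp add: n_def x_def add.commute)
      finally show ?thesis
        using insert.hyps Suc by (simp add: n_def Z_def del: binomial_Suc_Suc)
    qed
  qed
qed

section \<open>Maximizers of the collision form\<close>

text \<open>If \<open>m\<close> symbols are drawn from the distribution \<open>p\<close> on \<open>I\<close> and one from \<open>q\<close>, all independently, then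
  \<open>phi m I p q\<close> is the probability that the \<open>m + 1\<close> symbols are distinct.\<close>
definition phi :: "nat \<Rightarrow> 'a set \<Rightarrow> ('a \<Rightarrow> real) \<Rightarrow> ('a \<Rightarrow> real) \<Rightarrow> real" where
  "phi m I p q = fact m * (\<Sum>s\<in>I. q s * esym m (I - {s}) p)"

text \<open>The inner product is a positive semidefinite kernel, so it can be added to the symmetrised
  \<open>phi\<close> at no cost after averaging over a mixture; pointwise it compensates the pairs at which
  \<open>phi m I p q + phi m I q p\<close> exceeds its value at the uniform distribution.\<close>
definition coll_form :: "nat \<Rightarrow> real \<Rightarrow> 'a set \<Rightarrow> ('a \<Rightarrow> real) \<Rightarrow> ('a \<Rightarrow> real) \<Rightarrow> real" where
  "coll_form m \<kappa> I p q = phi m I p q + phi m I q p + \<kappa> * (\<Sum>s\<in>I. p s * q s)"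

definition simplex_on :: "'a set \<Rightarrow> ('a \<Rightarrow> real) set" where
  "simplex_on I = {p \<in> I \<rightarrow>\<^sub>E {0..1}. sum p I = 1}"

lemma simplex_onD:
  assumes "p \<in> simplex_on I"
  shows "sum p I = 1" "i \<in> I \<Longrightarrow> 0 \<le> p i" "i \<in> I \<Longrightarrow> p i \<le> 1"
  using assms by (auto simp: simplex_on_def PiE_iff)

text \<open>Sorting the symbol sets by whether they contain \<open>i\<close> and \<open>j\<close>
  shows that the values there enter only through \<open>p i + p j\<close>, \<open>q i + q j\<close>,
  \<open>p i * p j\<close> and \<open>q i * p j + q j * p i\<close>. A transfer between
  \<open>i\<close> and \<open>j\<close> changes only the last two.\<close>

lemma phi_insert2:
  assumes J: "finite J" "i \<notin> J" "j \<notin> J" "i \<noteq> j"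
  shows "phi (Suc (Suc l)) (insert i (insert j J)) p q = fact (Suc (Suc l)) *
    ((q i + q j) * esym (Suc (Suc l)) J p + (q i * p j + q j * p i) * esym (Suc l) J p +
     (\<Sum>s\<in>J. q s * esym (Suc (Suc l)) (J - {s}) p) +
     (p i + p j) * (\<Sum>s\<in>J. q s * esym (Suc l) (J - {s}) p) +
     p i * p j * (\<Sum>s\<in>J. q s * esym l (J - {s}) p))"
proof -
  have "insert i (insert j J) - {i} = insert j J" "insert i (insert j J) - {j} = insert i J"
    using J by auto
  moreover have "(\<Sum>s\<in>J. q s * esym (Suc (Suc l)) (insert i (insert j J) - {s}) p) =
     (\<Sum>s\<in>J. q s * esym (Suc (Suc l)) (J - {s}) p +
        (p i + p j) * (q s * esym (Suc l) (J - {s}) p) +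
        p i * p j * (q s * esym l (J - {s}) p))"
  proof (rule sum.cong[OF refl])
    fix s assume s: "s \<in> J"
    have "insert i (insert j J) - {s} = insert i (insert j (J - {s}))" using s J by auto
    then show "q s * esym (Suc (Suc l)) (insert i (insert j J) - {s}) p =
      q s * esym (Suc (Suc l)) (J - {s}) p + (p i + p j) * (q s * esym (Suc l) (J - {s}) p) +
        p i * p j * (q s * esym l (J - {s}) p)"
      using J by (simp add: esym_insert algebra_simps)
  qed
  ultimately show ?thesis
    using J unfolding phi_def
    by (simp add: esym_insert sum.distrib flip: sum_distrib_left del: fact_Suc)
       (simp add: algebra_simps del: fact_Suc)
qed

lemma sum_esym_cong:
  "(\<And>t. t \<in> J \<Longrightarrow> p t = p' t) \<Longrightarrow> (\<And>t. t \<in> J \<Longrightarrow> q t = q' t) \<Longrightarrow>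
    (\<Sum>s\<in>J. q s * esym m (J - {s}) p) = (\<Sum>s\<in>J. q' s * esym m (J - {s}) p')"
  by (intro sum.cong refl arg_cong2[where f = "(*)"] esym_cong) auto

text \<open>Swapping \<open>i\<close> and \<open>j\<close> negates the shift \<open>(x, y)\<close>
  and preserves the form, so there are no linear terms.\<close>

lemma coll_form_pair:
  fixes p q :: "'a \<Rightarrow> real"
  assumes "finite I" "i \<in> I" "j \<in> I" "i \<noteq> j" "2 \<le> m"
  obtains \<alpha> \<beta> \<delta> where "\<And>x y. coll_form m \<kappa> I (p(i := a + x, j := a - x)) (q(i := c + y, j := c - y)) =
    coll_form m \<kappa> I (p(i := a, j := a)) (q(i := c, j := c)) - (\<alpha> * x\<^sup>2 + \<beta> * y\<^sup>2 + \<delta> * (x * y))"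
proof -
  define J where "J = I - {i, j}"
  have J: "finite J" "i \<notin> J" "j \<notin> J" "i \<noteq> j" "I = insert i (insert j J)"
    using assms by (auto simp: J_def)
  obtain l where l: "m = Suc (Suc l)"
    using \<open>2 \<le> m\<close> le_Suc_ex[of 2 m] by auto
  define M where "M = (fact m :: real)"
  define A B where "A k = (\<Sum>s\<in>J. q s * esym k (J - {s}) p)"
     and "B k = (\<Sum>s\<in>J. p s * esym k (J - {s}) q)" for k
  define D where "D = (\<Sum>s\<in>J. p s * q s)"
  define \<alpha> \<beta> \<delta> where "\<alpha> = M * A l" and "\<beta> = M * B l"
    and "\<delta> = 2 * M * (esym (Suc l) J p + esym (Suc l) J q) - 2 * \<kappa>"
  have *: "coll_form m \<kappa> I (p(i := x1, j := x2)) (q(i := y1, j := y2)) =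
     M * ((y1 + y2) * esym m J p + (y1 * x2 + y2 * x1) * esym (Suc l) J p + A m + (x1 + x2) * A (Suc l) + x1 * x2 * A l)
   + M * ((x1 + x2) * esym m J q + (x1 * y2 + x2 * y1) * esym (Suc l) J q + B m + (y1 + y2) * B (Suc l) + y1 * y2 * B l)
   + \<kappa> * (x1 * y1 + x2 * y2 + D)" for x1 x2 y1 y2
  proof -
    define p' q' where "p' = p(i := x1, j := x2)" and "q' = q(i := y1, j := y2)"
    have v: "p' i = x1" "p' j = x2" "q' i = y1" "q' j = y2" using J by (auto simp: p'_def q'_def)
    have c: "\<And>t. t \<in> J \<Longrightarrow> p' t = p t" "\<And>t. t \<in> J \<Longrightarrow> q' t = q t"
      using J by (auto simp: p'_def q'_def)
    have e: "esym k J p' = esym k J p" "esym k J q' = esym k J q"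
      "(\<Sum>s\<in>J. q' s * esym k (J - {s}) p') = A k" "(\<Sum>s\<in>J. p' s * esym k (J - {s}) q') = B k" for k
      using c by (auto simp: A_def B_def intro!: esym_cong sum_esym_cong)
    have "(\<Sum>s\<in>J. p' s * q' s) = D" using c by (simp add: D_def)
    then have "(\<Sum>s\<in>I. p' s * q' s) = x1 * y1 + x2 * y2 + D" using J v by simp
    then show ?thesis
      unfolding p'_def[symmetric] q'_def[symmetric] coll_form_def J(5) l phi_insert2[OF J(1-4)] v e M_def
      by simp
  qed
  have "coll_form m \<kappa> I (p(i := a + x, j := a - x)) (q(i := c + y, j := c - y)) =
    coll_form m \<kappa> I (p(i := a, j := a)) (q(i := c, j := c)) - (\<alpha> * x\<^sup>2 + \<beta> * y\<^sup>2 + \<delta> * (x * y))" for x y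
    unfolding * \<alpha>_def \<beta>_def \<delta>_def by (simp add: algebra_simps power2_eq_square)
  then show ?thesis by (rule that)
qed

lemma compact_simplex_on:
  assumes "finite I"
  shows "compact (simplex_on I :: ('a \<Rightarrow> real) set)"
proof -
  \<comment> \<open>Members of the simplex equal \<open>undefined\<close> outside \<open>I\<close>;
    one-point factors there make the set a product over the whole type, to which Tychonoff's theorem
    applies.\<close>
  define S where "S i = (if i \<in> I then {0..1::real} else {undefined})" for i
  have eq: "(I \<rightarrow>\<^sub>E {0..1::real}) = PiE UNIV S"
    by (auto simp: S_def PiE_iff extensional_def split: if_splits)
  have "compactin (product_topology (\<lambda>i. euclidean) UNIV) (PiE UNIV S)"
    unfolding compactin_PiE by (auto simp: S_def)
  then have "compact (I \<rightarrow>\<^sub>E {0..1::real})"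
    by (simp add: eq euclidean_product_topology)
  moreover have "closed {p :: 'a \<Rightarrow> real. sum p I = 1}"
    by (intro closed_Collect_eq continuous_intros continuous_on_product_coordinates)
  ultimately have "compact ((I \<rightarrow>\<^sub>E {0..1}) \<inter> {p :: 'a \<Rightarrow> real. sum p I = 1})"
    by (rule compact_Int_closed)
  then show ?thesis by (simp add: simplex_on_def Collect_conj_eq)
qed

lemma continuous_on_fst_coord: "continuous_on S (\<lambda>z :: ('a \<Rightarrow> real) \<times> 'b :: topological_space. fst z t)"
  by (rule continuous_on_compose2[OF continuous_on_product_coordinates continuous_on_fst[OF continuous_on_id]]) auto

lemma continuous_on_snd_coord: "continuous_on S (\<lambda>z :: 'b :: topological_space \<times> ('a \<Rightarrow> real). snd z t)"
  by (rule continuous_on_compose2[OF continuous_on_product_coordinates continuous_on_snd[OF continuous_on_id]]) auto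

lemma continuous_on_coll_form: "continuous_on S (\<lambda>z. coll_form m \<kappa> I (fst z) (snd z))"
  unfolding coll_form_def phi_def esym_def
  by (intro continuous_intros continuous_on_fst_coord continuous_on_snd_coord)

lemma simplex_on_transfer:
  assumes p: "p \<in> simplex_on I" and ij: "finite I" "i \<in> I" "j \<in> I" "i \<noteq> j"
    and xy: "0 \<le> x" "0 \<le> y" "x + y = p i + p j"
  shows "p(i := x, j := y) \<in> simplex_on I"
proof -
  define J where "J = I - {i, j}"
  have J: "finite J" "i \<notin> J" "j \<notin> J" "I = insert i (insert j J)"
    using ij by (auto simp: J_def)
  have s: "sum p J + (p i + p j) = 1"
    using simplex_onD(1)[OF p] J ij by simp
  have "0 \<le> sum p J" using simplex_onD(2)[OF p] J by (intro sum_nonneg) auto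
  then have "x \<le> 1" "y \<le> 1" using s xy by linarith+
  moreover have "sum (p(i := x, j := y)) J = sum p J"
    using J by (intro sum.cong) auto
  ultimately show ?thesis
    using p s xy J ij by (auto simp: simplex_on_def PiE_iff extensional_def)
qed

lemma sum_sq_transfer:
  fixes p :: "'a \<Rightarrow> real"
  assumes "finite I" "i \<in> I" "j \<in> I" "i \<noteq> j"
  shows "(\<Sum>s\<in>I. ((p(i := a + x, j := a - x)) s)\<^sup>2) = (\<Sum>s\<in>I. ((p(i := a, j := a)) s)\<^sup>2) + 2 * x\<^sup>2"
proof -
  define J where "J = I - {i, j}"
  have J: "finite J" "i \<notin> J" "j \<notin> J" "I = insert i (insert j J)"
    using assms by (auto simp: J_def)
  have "(\<Sum>s\<in>J. ((p(i := u, j := v)) s)\<^sup>2) = (\<Sum>s\<in>J. (p s)\<^sup>2)" for u v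
    using J by (intro sum.cong) auto
  then show ?thesis using J assms(4) by (simp add: power2_eq_square algebra_simps)
qed

text \<open>Among all maximizers choose one with least sum of squares. On a pair of coordinates where all four
  entries are positive, equalizing cannot decrease the form (else moving further apart would
  increase it), so the pair is already equal.\<close>
lemma coll_form_maximizer:
  fixes I :: "'a set"
  assumes I: "finite I" "I \<noteq> {}" and m: "2 \<le> m"
  obtains p q where "p \<in> simplex_on I" "q \<in> simplex_on I"
    "\<And>p' q'. p' \<in> simplex_on I \<Longrightarrow> q' \<in> simplex_on I \<Longrightarrow> coll_form m \<kappa> I p' q' \<le> coll_form m \<kappa> I p q"
    "\<And>i j. i \<in> I \<Longrightarrow> j \<in> I \<Longrightarrow> 0 < p i \<Longrightarrow> 0 < p j \<Longrightarrow> 0 < q i \<Longrightarrow> 0 < q j \<Longrightarrow> p i = p j \<and> q i = q j"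
proof -
  define G where "G z = coll_form m \<kappa> I (fst z) (snd z)" for z
  define K where "K = (simplex_on I \<times> simplex_on I :: (('a \<Rightarrow> real) \<times> ('a \<Rightarrow> real)) set)"
  define Q where "Q z = (\<Sum>s\<in>I. (fst z s)\<^sup>2) + (\<Sum>s\<in>I. (snd z s)\<^sup>2)" for z :: "('a \<Rightarrow> real) \<times> ('a \<Rightarrow> real)"
  have contG: "continuous_on S G" for S unfolding G_def by (rule continuous_on_coll_form)
  have contQ: "continuous_on S Q" for S
    unfolding Q_def by (intro continuous_intros continuous_on_fst_coord continuous_on_snd_coord)
  obtain i0 where "i0 \<in> I" using I by blast
  then have "(\<lambda>s\<in>I. if s = i0 then 1 else 0) \<in> simplex_on I"
    using I by (auto simp: simplex_on_def)
  then have K: "compact K" "K \<noteq> {}"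
    using compact_simplex_on[OF I(1)] by (auto simp: K_def intro: compact_Times)
  obtain z0 where z0: "z0 \<in> K" "\<And>z. z \<in> K \<Longrightarrow> G z \<le> G z0"
    using continuous_attains_sup[OF K contG] by blast
  define L where "L = K \<inter> {z. G z = G z0}"
  have "compact L"
    unfolding L_def by (intro compact_Int_closed K closed_Collect_eq contG continuous_intros)
  moreover have "L \<noteq> {}" using z0 by (auto simp: L_def)
  ultimately have "\<exists>z\<in>L. \<forall>z'\<in>L. Q z \<le> Q z'"
    by (rule continuous_attains_inf[OF _ _ contQ])
  then obtain z where z: "z \<in> L" "\<And>z'. z' \<in> L \<Longrightarrow> Q z \<le> Q z'"
    by blast
  obtain p q where pq: "z = (p, q)" by (cases z)
  have p: "p \<in> simplex_on I" and q: "q \<in> simplex_on I" and Gz: "coll_form m \<kappa> I p q = G z0"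
    using z(1) by (auto simp: L_def K_def pq G_def)
  have max: "coll_form m \<kappa> I p' q' \<le> coll_form m \<kappa> I p q" if "p' \<in> simplex_on I" "q' \<in> simplex_on I" for p' q'
    using z0(2)[of "(p', q')"] that by (simp add: Gz K_def) (simp add: G_def)
  have eq: "p i = p j \<and> q i = q j"
    if ij: "i \<in> I" "j \<in> I" "0 < p i" "0 < p j" "0 < q i" "0 < q j" for i j
  proof (cases "i = j")
    case False
    define a x c y where "a = (p i + p j) / 2" and "x = (p i - p j) / 2"
      and "c = (q i + q j) / 2" and "y = (q i - q j) / 2"
    obtain \<alpha> \<beta> \<delta> where form: "\<And>x y. coll_form m \<kappa> I (p(i := a + x, j := a - x)) (q(i := c + y, j := c - y)) =
        coll_form m \<kappa> I (p(i := a, j := a)) (q(i := c, j := c)) - (\<alpha> * x\<^sup>2 + \<beta> * y\<^sup>2 + \<delta> * (x * y))"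
      using coll_form_pair[OF I(1) ij(1,2) False m] by blast
    define f where "f = \<alpha> * x\<^sup>2 + \<beta> * y\<^sup>2 + \<delta> * (x * y)"
    have pe: "p(i := a + x, j := a - x) = p" and qe: "q(i := c + y, j := c - y) = q"
      by (auto simp: a_def x_def c_def y_def fun_eq_iff field_simps)
    \<comment> \<open>The given pair is \<open>t = 1\<close> and the equalised one is
      \<open>t = 0\<close>. Maximality yields \<open>f \<le> 0\<close> from \<open>t = 0\<close> and
      \<open>0 \<le> f\<close> from some \<open>t > 1\<close>, so both pairs are maximizers.\<close>
    have scaled: "coll_form m \<kappa> I (p(i := a + t * x, j := a - t * x)) (q(i := c + t * y, j := c - t * y)) =
       coll_form m \<kappa> I p q + (1 - t\<^sup>2) * f" for t
      using form[of "t * x" "t * y"] form[of x y] unfolding pe qe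
      by (simp add: f_def power2_eq_square algebra_simps)
    have mem: "p(i := a + t * x, j := a - t * x) \<in> simplex_on I"
      "q(i := c + t * y, j := c - t * y) \<in> simplex_on I"
      if "\<bar>t * x\<bar> \<le> a" "\<bar>t * y\<bar> \<le> c" for t
    proof -
      have "0 \<le> a + t * x" "0 \<le> a - t * x" "0 \<le> c + t * y" "0 \<le> c - t * y"
        using that by (simp_all add: abs_le_iff)
      moreover have "a + t * x + (a - t * x) = p i + p j" "c + t * y + (c - t * y) = q i + q j"
        by (simp_all add: a_def c_def)
      ultimately show "p(i := a + t * x, j := a - t * x) \<in> simplex_on I"
        "q(i := c + t * y, j := c - t * y) \<in> simplex_on I"
        by (auto intro: simplex_on_transfer[OF p I(1) ij(1,2) False] simplex_on_transfer[OF q I(1) ij(1,2) False])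
    qed
    have lt: "\<bar>x\<bar> < a" "\<bar>y\<bar> < c" using ij by (auto simp: x_def a_def y_def c_def abs_less_iff intro: divide_strict_right_mono)
    \<comment> \<open>Any \<open>t > 1\<close> that keeps the four entries nonnegative would do; one
      exists because positive entries give \<open>\<bar>x\<bar> < a\<close> and
      \<open>\<bar>y\<bar> < c\<close>.\<close>
    define t where "t = min (a / (\<bar>x\<bar> + a) * 2) (c / (\<bar>y\<bar> + c) * 2)"
    have pos: "0 < \<bar>x\<bar> + a" "0 < \<bar>y\<bar> + c" using lt by linarith+
    have t: "1 < t" using lt pos by (auto simp: t_def field_simps)
    have "t \<le> a / (\<bar>x\<bar> + a) * 2" "t \<le> c / (\<bar>y\<bar> + c) * 2" by (auto simp: t_def)
    then have t': "t * (\<bar>x\<bar> + a) \<le> 2 * a" "t * (\<bar>y\<bar> + c) \<le> 2 * c" using pos by (auto simp: field_simps)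
    have "0 \<le> a" "0 \<le> c" using lt by linarith+
    then have "t * \<bar>x\<bar> \<le> a" "t * \<bar>y\<bar> \<le> c"
      using t' mult_right_mono[of 1 t a] mult_right_mono[of 1 t c] t lt by (auto simp: algebra_simps)
    then have "\<bar>t * x\<bar> \<le> a" "\<bar>t * y\<bar> \<le> c" using t by (auto simp: abs_mult)
    from max[OF mem[OF this]] have "(1 - t\<^sup>2) * f \<le> 0" by (simp add: scaled)
    moreover have "1 - t\<^sup>2 < 0" using t by (simp add: one_less_power)
    ultimately have "0 \<le> f" by (simp add: mult_le_0_iff)
    moreover have mem0: "\<bar>0 * x\<bar> \<le> a" "\<bar>0 * y\<bar> \<le> c" using lt by auto
    from max[OF mem[OF mem0]] have "f \<le> 0" unfolding scaled by simp
    ultimately have "f = 0" by simp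
    define z' where "z' = (p(i := a, j := a), q(i := c, j := c))"
    have "z' \<in> L"
      using mem[OF mem0] scaled[of 0] \<open>f = 0\<close> Gz by (simp add: L_def K_def z'_def) (simp add: G_def)
    from z(2)[OF this] have "Q z \<le> Q z'" .
    moreover have "Q z = Q z' + 2 * x\<^sup>2 + 2 * y\<^sup>2"
      using sum_sq_transfer[OF I(1) ij(1,2) False, of p a x] sum_sq_transfer[OF I(1) ij(1,2) False, of q c y]
      unfolding pe qe by (simp add: Q_def pq z'_def)
    ultimately have "x\<^sup>2 + y\<^sup>2 \<le> 0" by simp
    then have "x = 0" "y = 0" by (auto simp: sum_power2_le_zero_iff)
    then show ?thesis by (simp add: x_def y_def)
  qed simp
  show ?thesis using that[OF p q max eq] .
qed

section \<open>Bounds in the presence of zeros\<close>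

text \<open>The maximum of \<open>fact m * esym m J p\<close> over distributions \<open>p\<close> on \<open>n\<close> symbols\<close>
definition fall :: "nat \<Rightarrow> nat \<Rightarrow> real" where
  "fall m n = fact m * real (n choose m) / real n ^ m"

lemma fall_nonneg: "0 \<le> fall m n"
  by (simp add: fall_def)

lemma esym_le_fall:
  assumes "finite J" "\<And>t. t \<in> J \<Longrightarrow> 0 \<le> p t"
  shows "fact m * esym m J p \<le> fall m (card J) * sum p J ^ m"
proof -
  have "fact m * esym m J p \<le> fact m * (real (card J choose m) * (sum p J / real (card J)) ^ m)"
    using assms by (intro mult_left_mono esym_maclaurin) auto
  then show ?thesis by (simp add: fall_def power_divide)
qed

text \<open>Double counting: an \<open>m\<close>-subset survives the removal of \<open>s\<close> for
  exactly the \<open>card I - m\<close> elements \<open>s\<close> outside it.\<close>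

lemma sum_esym_remove:
  assumes "finite I" "m \<le> card I"
  shows "(\<Sum>s\<in>I. esym m (I - {s}) p) = real (card I - m) * esym m I p"
proof -
  define S where "S = {T. T \<subseteq> I \<and> card T = m}"
  have fin: "finite S" using assms by (simp add: S_def)
  have "(\<Sum>s\<in>I. esym m (I - {s}) p) = (\<Sum>s\<in>I. \<Sum>T\<in>S. if s \<notin> T then \<Prod>t\<in>T. p t else 0)"
  proof (rule sum.cong[OF refl])
    fix s assume "s \<in> I"
    have "{T. T \<subseteq> I - {s} \<and> card T = m} = {T \<in> S. s \<notin> T}" by (auto simp: S_def)
    then show "esym m (I - {s}) p = (\<Sum>T\<in>S. if s \<notin> T then \<Prod>t\<in>T. p t else 0)"
      by (simp add: esym_def sum.inter_filter[OF fin])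
  qed
  also have "\<dots> = (\<Sum>T\<in>S. \<Sum>s\<in>I. if s \<notin> T then \<Prod>t\<in>T. p t else 0)"
    by (rule sum.swap)
  also have "\<dots> = (\<Sum>T\<in>S. real (card I - m) * (\<Prod>t\<in>T. p t))"
  proof (rule sum.cong[OF refl])
    fix T assume T: "T \<in> S"
    then have "card {s \<in> I. s \<notin> T} = card I - m"
      using card_Diff_subset[of T I] finite_subset[OF _ assms(1)] by (auto simp: S_def set_diff_eq)
    then show "(\<Sum>s\<in>I. if s \<notin> T then \<Prod>t\<in>T. p t else 0) = real (card I - m) * (\<Prod>t\<in>T. p t)"
      by (simp add: sum.inter_filter[OF assms(1), symmetric])
  qed
  finally show ?thesis by (simp add: esym_def S_def sum_distrib_left)
qed

text \<open>Outside \<open>S\<close> each \<open>esym m (I - {s}) p\<close> is bounded by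
  \<open>esym m I p\<close>. On \<open>S\<close> the weight \<open>q\<close> is constant, so only
  the sum of these terms counts. Deleting a zero of \<open>p\<close> loses nothing, hence
  \<open>Z\<close> uses up \<open>card Z\<close> of the total
  \<open>(card I - m) * esym m I p\<close> and leaves the rest for \<open>S\<close>.\<close>

lemma phi_le_esym:
  assumes I: "finite I" and pos: "\<And>t. t \<in> I \<Longrightarrow> 0 \<le> p t" "\<And>t. t \<in> I \<Longrightarrow> 0 \<le> q t"
    and q: "sum q I = 1"
    and S: "S \<subseteq> I" "\<And>t. t \<in> S \<Longrightarrow> q t = c" "S \<noteq> {}"
    and Z: "Z \<subseteq> I" "S \<inter> Z = {}" "\<And>t. t \<in> Z \<Longrightarrow> p t = 0" "m + card Z \<le> card I"
  shows "phi m I p q \<le> fact m * esym m I p *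
    ((1 - sum q S) + sum q S * (real (card I - m - card Z) / real (card S)))"
proof -
  define e where "e = esym m I p"
  have e: "0 \<le> e" using pos by (auto simp: e_def intro: esym_nonneg)
  have fin: "finite S" "finite Z" using S Z I finite_subset by blast+
  have le: "esym m (I - {s}) p \<le> e" for s
    unfolding e_def using I pos by (intro esym_mono_set) auto
  have "(\<Sum>s\<in>Z. esym m (I - {s}) p) = (\<Sum>s\<in>Z. e)"
  proof (rule sum.cong[OF refl])
    fix s assume "s \<in> Z"
    then show "esym m (I - {s}) p = e"
      using Z I unfolding e_def by (intro esym_subset[symmetric]) auto
  qed
  moreover have "(\<Sum>s\<in>S. esym m (I - {s}) p) + (\<Sum>s\<in>Z. esym m (I - {s}) p) \<le> (\<Sum>s\<in>I. esym m (I - {s}) p)"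
    using I fin S Z pos
    by (subst sum.union_disjoint[symmetric]) (auto intro!: sum_mono2 esym_nonneg)
  ultimately have sumS: "(\<Sum>s\<in>S. esym m (I - {s}) p) \<le> real (card I - m - card Z) * e"
    using Z(4) I by (simp add: sum_esym_remove e_def of_nat_diff algebra_simps)
  have "c = q (SOME x. x \<in> S)" using S by (metis some_in_eq)
  then have c: "0 \<le> c" using S pos by (metis some_in_eq subsetD)
  have qS: "sum q S = real (card S) * c" using S by simp
  have "(\<Sum>s\<in>I. q s * esym m (I - {s}) p) =
      (\<Sum>s\<in>I - S. q s * esym m (I - {s}) p) + (\<Sum>s\<in>S. q s * esym m (I - {s}) p)"
    using I S by (intro sum.subset_diff) auto
  also have "(\<Sum>s\<in>S. q s * esym m (I - {s}) p) = c * (\<Sum>s\<in>S. esym m (I - {s}) p)"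
    using S by (simp add: sum_distrib_left)
  also have "c * (\<Sum>s\<in>S. esym m (I - {s}) p) \<le> c * (real (card I - m - card Z) * e)"
    by (intro mult_left_mono sumS c)
  also have "(\<Sum>s\<in>I - S. q s * esym m (I - {s}) p) \<le> (\<Sum>s\<in>I - S. q s * e)"
    using pos by (intro sum_mono mult_left_mono le) auto
  also have "\<dots> = (1 - sum q S) * e"
    using q sum.subset_diff[OF S(1) I, of q] by (simp add: sum_distrib_right[symmetric])
  also have "(1 - sum q S) * e + c * (real (card I - m - card Z) * e) =
     e * ((1 - sum q S) + sum q S * (real (card I - m - card Z) / real (card S)))"
    using S fin by (simp add: qS algebra_simps)
  finally show ?thesis
    unfolding phi_def e_def[symmetric] by (simp add: mult.assoc)
qed

text \<open>Scaling the coordinates outside the small set \<open>S\<close> by \<open>\<sigma>\<close> increases the elementary symmetric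
  polynomial at least by \<open>\<sigma> ^ u\<close>; the \<open>\<sigma>\<close> used here balances the two parts.\<close>
lemma esym_le_mass_outside:
  assumes I: "finite I" "\<And>t. t \<in> I \<Longrightarrow> 0 \<le> p t" and p: "sum p I = 1"
    and S: "S \<subseteq> I" "S \<noteq> {}" and m: "m = u + card S" "2 \<le> u"
    and Z: "Z \<subseteq> I" "\<And>t. t \<in> Z \<Longrightarrow> p t = 0"
    and \<theta>: "0 < \<theta>" "real m * \<theta> \<le> real u"
      "\<theta> * (real m ^ m * real (u - 1) ^ (u - 1)) \<le> real u ^ u * real (m - 1) ^ (m - 1)"
  shows "fact m * esym m I p \<le> fall m (card (I - Z)) * min 1 (sum p (I - S) / \<theta>)"
proof -
  define A where "A = sum p (I - S)"
  define E where "E = fall m (card (I - Z))"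
  define n where "n = card S"
  have finS: "finite S" using S I finite_subset by blast
  have n: "0 < n" using S finS by (simp add: n_def card_gt_0_iff)
  have E: "0 \<le> E" by (simp add: E_def fall_nonneg)
  have bound: "fact m * esym m I p' \<le> E * sum p' I ^ m"
    if "\<And>t. t \<in> I \<Longrightarrow> 0 \<le> p' t" "\<And>t. t \<in> Z \<Longrightarrow> p' t = 0" for p'
  proof -
    have "esym m I p' = esym m (I - Z) p'"
      using I that by (intro esym_subset) auto
    moreover have "sum p' I = sum p' (I - Z)"
      using I Z that by (intro sum.mono_neutral_right) auto
    ultimately show ?thesis
      using esym_le_fall[of "I - Z" p' m] I that by (simp add: E_def)
  qed
  have b1: "fact m * esym m I p \<le> E" using bound[of p] I Z p by simp
  have A0: "0 \<le> A" using I by (auto simp: A_def intro: sum_nonneg)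
  have SA: "sum p S = 1 - A"
    using p sum.subset_diff[OF S(1) I(1), of p] by (simp add: A_def)
  have b2: "fact m * esym m I p \<le> E * (A / \<theta>)" if "A \<le> \<theta>"
  proof (cases "A = 0")
    case True
    then have "\<forall>t\<in>I - S. p t = 0"
      using I sum_nonneg_eq_0_iff[of "I - S" p] by (auto simp: A_def)
    then have "esym m I p = esym m S p" using I S by (intro esym_subset) auto
    also have "\<dots> = 0" using finS m by (intro esym_eq_0) auto
    finally show ?thesis using True by simp
  next
    case False
    then have A: "0 < A" using A0 by simp
    have mA: "real m * A \<le> real u" using that \<theta>(2) mult_left_mono[OF that, of "real m"] by simp
    moreover have "real u < real m" using m n by (simp add: n_def)
    ultimately have "real m * A < real m * 1" by linarith
    then have A1: "A < 1" by (rule mult_left_less_imp_less) simp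
    \<comment> \<open>After scaling, the masses inside and outside \<open>S\<close> are in the ratio
      \<open>n : u\<close>. The factor is at least 1 because \<open>A \<le> \<theta>\<close> and
      \<open>real m * \<theta> \<le> real u\<close>.\<close>
    define \<sigma> where "\<sigma> = real u * (1 - A) / (real n * A)"
    have \<sigma>: "1 \<le> \<sigma>"
      using mA A n m by (simp add: \<sigma>_def n_def field_simps)
    define p' where "p' t = (if t \<in> S then p t else \<sigma> * p t)" for t
    have "\<sigma> ^ u * esym m I p \<le> esym m I p'"
      unfolding esym_def sum_distrib_left
    proof (rule sum_mono)
      fix T assume "T \<in> {T. T \<subseteq> I \<and> card T = m}"
      then have T: "T \<subseteq> I" "card T = m" "finite T" using I finite_subset by auto
      have "card (T \<inter> S) \<le> card S" using finS by (intro card_mono) auto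
      moreover have "card (T - S) + card (T \<inter> S) = m"
        using T card_Diff_subset_Int[of T S] card_mono[of T "T \<inter> S"] by auto
      ultimately have u: "u \<le> card (T - S)" using m by simp
      have "(\<Prod>t\<in>T. p' t) = (\<Prod>t\<in>T. (if t \<in> S then 1 else \<sigma>) * p t)"
        by (intro prod.cong) (auto simp: p'_def)
      also have "\<dots> = (\<Prod>t\<in>T. if t \<in> S then 1 else \<sigma>) * (\<Prod>t\<in>T. p t)"
        by (rule prod.distrib)
      also have "(\<Prod>t\<in>T. if t \<in> S then 1 else \<sigma>) = \<sigma> ^ card (T - S)"
        using T(3) by (subst prod.If_cases) (auto simp: Diff_eq)
      finally have "(\<Prod>t\<in>T. p' t) = \<sigma> ^ card (T - S) * (\<Prod>t\<in>T. p t)" .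
      moreover have "\<sigma> ^ u \<le> \<sigma> ^ card (T - S)" using \<sigma> u by (rule power_increasing[rotated])
      ultimately show "\<sigma> ^ u * (\<Prod>t\<in>T. p t) \<le> (\<Prod>t\<in>T. p' t)"
        using T I by (simp add: mult_right_mono prod_nonneg subset_iff)
    qed
    then have "\<sigma> ^ u * (fact m * esym m I p) \<le> fact m * esym m I p'"
      using mult_left_mono[of _ _ "fact m :: real"] by (simp add: mult.left_commute)
    also have "\<dots> \<le> E * sum p' I ^ m"
      using I Z \<sigma> by (intro bound) (auto simp: p'_def)
    also have "sum p' I = (1 - A) + \<sigma> * A"
    proof -
      have "sum p' I = sum p' (I - S) + sum p' S" by (rule sum.subset_diff[OF S(1) I(1)])
      also have "sum p' S = 1 - A" by (simp add: p'_def SA[symmetric])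
      also have "sum p' (I - S) = \<sigma> * A" by (simp add: p'_def A_def sum_distrib_left)
      finally show ?thesis by simp
    qed
    also have "\<dots> = (1 - A) * real m / real n"
      using A n m by (simp add: \<sigma>_def n_def field_simps)
    finally have main: "\<sigma> ^ u * (fact m * esym m I p) \<le> E * ((1 - A) * real m / real n) ^ m" .
    \<comment> \<open>AM-GM, sharp at \<open>A = (u - 1) / (m - 1)\<close>. The exponent is
      \<open>u - 1\<close> because one factor \<open>A\<close> is kept for the linear bound
      \<open>A / \<theta>\<close>; the last condition on \<open>\<theta>\<close> is tailored to this
      maximum.\<close>
    have am: "A ^ (u - 1) * (1 - A) ^ n * real (m - 1) ^ (m - 1) \<le> real (u - 1) ^ (u - 1) * real n ^ n"
    proof -
      define w where "w = real (m - 1)"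
      have pos: "0 < real (u - 1)" "0 < real n" "0 < w" using m n by (auto simp: w_def n_def)
      have w: "w = real (u - 1) + real n" using m by (simp add: w_def n_def)
      have "(A * w / real (u - 1)) ^ (u - 1) * ((1 - A) * w / real n) ^ n \<le> 1"
      proof (rule power_mult_le_1)
        have "real (u - 1) * (A * w / real (u - 1)) + real n * ((1 - A) * w / real n) = A * w + (1 - A) * w"
          using pos by simp
        also have "\<dots> = w" by (simp add: algebra_simps)
        finally show "real (u - 1) * (A * w / real (u - 1)) + real n * ((1 - A) * w / real n) \<le> real (u - 1) + real n"
          by (simp only: w)
      qed (use pos A A1 in auto)
      then have "(A * w) ^ (u - 1) * ((1 - A) * w) ^ n \<le> real (u - 1) ^ (u - 1) * real n ^ n"
        using pos by (simp add: power_divide divide_le_eq del: of_nat_diff)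
      moreover have "m - 1 = (u - 1) + n" using m by (simp add: n_def)
      then have "A ^ (u - 1) * (1 - A) ^ n * w ^ (m - 1) = (A * w) ^ (u - 1) * ((1 - A) * w) ^ n"
        unfolding power_mult_distrib by (simp only: power_add mult_ac)
      ultimately show ?thesis unfolding w_def by linarith
    qed
    have key: "((1 - A) * real m / real n) ^ m \<le> \<sigma> ^ u * (A / \<theta>)"
    proof -
      have mn: "m = u + n" using m by (simp add: n_def)
      obtain v where v: "u = Suc v" using m(2) by (cases u) auto
      define X where "X = real n ^ n * real n ^ u"
      have pos: "0 < real n" "0 < real u" "0 < real (m - 1)" using n m by auto
      have "\<theta> * real m ^ m * (A ^ v * (1 - A) ^ n) * real (m - 1) ^ (m - 1)
            \<le> \<theta> * real m ^ m * (real v ^ v * real n ^ n)"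
        using mult_left_mono[OF am, of "\<theta> * real m ^ m"] \<theta>(1) v by (simp add: mult.assoc)
      also have "\<dots> = (\<theta> * (real m ^ m * real v ^ v)) * real n ^ n" by simp
      also have "\<dots> \<le> (real u ^ u * real (m - 1) ^ (m - 1)) * real n ^ n"
        using \<theta>(3) v by (intro mult_right_mono) auto
      finally have "(\<theta> * real m ^ m * (A ^ v * (1 - A) ^ n)) * real (m - 1) ^ (m - 1) \<le>
          (real u ^ u * real n ^ n) * real (m - 1) ^ (m - 1)" by (simp add: mult.assoc mult.left_commute mult.commute)
      then have *: "\<theta> * real m ^ m * (A ^ v * (1 - A) ^ n) \<le> real u ^ u * real n ^ n"
        using pos by (simp add: mult_le_cancel_right)
      have "\<theta> * (real m ^ m * (1 - A) ^ m) * A ^ u = (\<theta> * real m ^ m * (A ^ v * (1 - A) ^ n)) * (A * (1 - A) ^ u)"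
        by (simp add: v mn power_add mult_ac)
      also have "\<dots> \<le> (real u ^ u * real n ^ n) * (A * (1 - A) ^ u)"
        using * A A1 by (intro mult_right_mono) auto
      finally have **: "\<theta> * (real m ^ m * (1 - A) ^ m) * A ^ u \<le> (real u ^ u * real n ^ n) * (A * (1 - A) ^ u)" .
      have "((1 - A) * real m / real n) ^ m = (real m ^ m * (1 - A) ^ m) / (real n ^ u * real n ^ n)"
        by (simp add: power_divide power_mult_distrib mn power_add mult_ac)
      moreover have "\<sigma> ^ u * (A / \<theta>) = real u ^ u * (1 - A) ^ u * A / (real n ^ u * A ^ u * \<theta>)"
        by (simp add: \<sigma>_def power_divide power_mult_distrib)
      moreover have "P / (K * N) \<le> U * W * A / (K * Q * \<theta>)"
        if "\<theta> * P * Q \<le> (U * N) * (A * W)" "0 < K" "0 < N" "0 < Q" for P K N U W Q :: real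
      proof -
        have "P / (K * N) = (\<theta> * P * Q) / (K * N * Q * \<theta>)" using that \<theta>(1) by simp
        also have "\<dots> \<le> (U * N) * (A * W) / (K * N * Q * \<theta>)"
          using that \<theta>(1) by (intro divide_right_mono) auto
        also have "\<dots> = U * W * A / (K * Q * \<theta>)" using that by (simp add: mult_ac)
        finally show ?thesis .
      qed
      ultimately show ?thesis using ** pos A by simp
    qed
    have "\<sigma> ^ u * (fact m * esym m I p) \<le> \<sigma> ^ u * (E * (A / \<theta>))"
      using main mult_left_mono[OF key E] by (simp add: mult.left_commute)
    then show ?thesis by (rule mult_left_le_imp_le) (use \<sigma> in auto)
  qed
  show ?thesis
  proof (cases "A \<le> \<theta>")
    case True
    then have "min 1 (A / \<theta>) = A / \<theta>" using \<theta>(1) by simp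
    then show ?thesis using b2[OF True] by (simp add: A_def E_def)
  next
    case False
    then have "min 1 (A / \<theta>) = 1" using \<theta>(1) by simp
    then show ?thesis using b1 by (simp add: A_def E_def)
  qed
qed

lemma coll_form_commute: "coll_form m \<kappa> I p q = coll_form m \<kappa> I q p"
  by (simp add: coll_form_def mult.commute add.commute)

text \<open>The left side is an average over \<open>q\<close> of terms for single symbols
  \<open>s\<close>. The symbols other than \<open>s\<close> carry mass \<open>1 - p s\<close> of
  \<open>p\<close>, so each term is at most \<open>B * (1 - p s) + B * p s\<close>. This serves
  pairs for which the other \<open>phi\<close> vanishes.\<close>

lemma phi_add_inner_le:
  assumes I: "finite I" and m: "0 < m" and p: "p \<in> simplex_on I" and q: "q \<in> simplex_on I"
    and "fall m (card I - 1) \<le> B" "\<kappa> \<le> B"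
  shows "phi m I p q + \<kappa> * (\<Sum>s\<in>I. p s * q s) \<le> B"
proof -
  define E where "E = fall m (card I - 1)"
  have "phi m I p q + \<kappa> * (\<Sum>s\<in>I. p s * q s) =
      (\<Sum>s\<in>I. q s * (fact m * esym m (I - {s}) p + \<kappa> * p s))"
    unfolding phi_def sum_distrib_left sum.distrib[symmetric]
    by (intro sum.cong) (auto simp: algebra_simps)
  also have "\<dots> \<le> (\<Sum>s\<in>I. q s * B)"
  proof (intro sum_mono mult_left_mono)
    fix s assume s: "s \<in> I"
    have ps: "0 \<le> p s" "p s \<le> 1" using simplex_onD[OF p] s by auto
    have "sum p (I - {s}) = 1 - p s"
      using simplex_onD(1)[OF p] s I by (simp add: sum_diff1)
    then have "fact m * esym m (I - {s}) p \<le> E * (1 - p s) ^ m"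
      using esym_le_fall[of "I - {s}" p m] simplex_onD(2)[OF p] I s by (simp add: E_def)
    also have "(1 - p s) ^ m \<le> (1 - p s) ^ 1"
      using ps m by (intro power_decreasing) auto
    finally have "fact m * esym m (I - {s}) p \<le> E * (1 - p s)"
      by (simp add: E_def fall_nonneg mult_left_mono)
    also have "E * (1 - p s) \<le> B * (1 - p s)"
      using assms ps by (intro mult_right_mono) (auto simp: E_def)
    finally have "fact m * esym m (I - {s}) p + \<kappa> * p s \<le> B * (1 - p s) + B * p s"
      using assms ps by (intro add_mono mult_right_mono) auto
    then show "fact m * esym m (I - {s}) p + \<kappa> * p s \<le> B" by (simp add: algebra_simps)
  qed (use simplex_onD[OF q] in auto)
  also have "\<dots> = B" using simplex_onD(1)[OF q] by (simp flip: sum_distrib_right)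
  finally show ?thesis .
qed

lemma phi_eq_0:
  assumes "finite I" "card {s \<in> I. p s \<noteq> 0} < m"
  shows "phi m I p q = 0"
proof -
  have "esym m (I - {s}) p = 0" for s
  proof -
    have "esym m (I - {s}) p = esym m {t \<in> I - {s}. p t \<noteq> 0} p"
      using assms by (intro esym_subset) auto
    also have "\<dots> = 0"
    proof (rule esym_eq_0)
      have "card {t \<in> I - {s}. p t \<noteq> 0} \<le> card {s \<in> I. p s \<noteq> 0}"
        using assms by (intro card_mono) auto
      then show "card {t \<in> I - {s}. p t \<noteq> 0} < m" using assms(2) by simp
    qed (use assms in auto)
    finally show ?thesis .
  qed
  then show ?thesis by (simp add: phi_def)
qed

text \<open>The point \<open>(A, min 1 (A / \<theta>))\<close> lies on the segment from
  \<open>(0, 0)\<close> to \<open>(\<theta>, 1)\<close> or on that from \<open>(\<theta>, 1)\<close>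
  to \<open>(1, 1)\<close>, and an affine function on a segment is bounded by its values at the
  ends.\<close>

lemma affine_min_le:
  fixes c0 c1 c2 A \<theta> B :: real
  assumes "0 < \<theta>" "\<theta> < 1" "0 \<le> A" "A \<le> 1"
    and "c0 \<le> B" "c0 + c1 * \<theta> + c2 \<le> B" "c0 + c1 + c2 \<le> B"
  shows "c0 + c1 * A + c2 * min 1 (A / \<theta>) \<le> B"
proof (cases "A \<le> \<theta>")
  case True
  define w where "w = A / \<theta>"
  have w: "0 \<le> w" "w \<le> 1" "A = w * \<theta>" using assms True by (auto simp: w_def)
  have "c0 + c1 * A + c2 * min 1 (A / \<theta>) = (1 - w) * c0 + w * (c0 + c1 * \<theta> + c2)"
  proof -
    have "min 1 (A / \<theta>) = w" using w(1,2) by (simp add: w_def[symmetric] min_def)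
    moreover have "c1 * A = w * (c1 * \<theta>)" using w(3) by simp
    ultimately show ?thesis by (simp add: algebra_simps)
  qed
  also have "\<dots> \<le> (1 - w) * B + w * B" using w assms by (intro add_mono mult_left_mono) auto
  finally show ?thesis by (simp add: algebra_simps)
next
  case False
  define w where "w = (1 - A) / (1 - \<theta>)"
  have w: "0 \<le> w" "w \<le> 1" using assms False by (auto simp: w_def)
  have "w * (1 - \<theta>) = 1 - A" using assms by (simp add: w_def)
  then have A: "A = w * \<theta> + (1 - w)" by (simp add: algebra_simps)
  have "c0 + c1 * A + c2 * min 1 (A / \<theta>) = c0 + c1 * A + c2"
    using False assms by (simp add: min_def)
  also have "\<dots> = w * (c0 + c1 * \<theta> + c2) + (1 - w) * (c0 + c1 + c2)"
    by (subst A) (simp add: algebra_simps)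
  also have "\<dots> \<le> w * B + (1 - w) * B" using w assms by (intro add_mono mult_left_mono) auto
  finally show ?thesis by (simp add: algebra_simps)
qed

text \<open>The value of \<open>phi\<close> when both arguments are uniform on \<open>b\<close> symbols\<close>
definition unif_val :: "nat \<Rightarrow> nat \<Rightarrow> real" where
  "unif_val m b = fact m * real (b - 1 choose m) / real b ^ m"

text \<open>The value of \<open>coll_form m (2 * unif_val m b)\<close> when both arguments are
  uniform, since their inner product is \<open>1 / b\<close>.\<close>

definition coll_bound :: "nat \<Rightarrow> nat \<Rightarrow> real" where
  "coll_bound m b = 2 * unif_val m b * (1 + 1 / real b)"

text \<open>Bound for the form when \<open>q\<close> vanishes at \<open>i\<close> symbols, \<open>p\<close> at \<open>j\<close> others, and \<open>p\<close>, \<open>q\<close> are constant with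
  total masses \<open>A\<close>, \<open>C\<close> on the remaining ones; \<open>x\<close>, \<open>y\<close> bound the ratios of the elementary symmetric
  polynomials to their Maclaurin bounds. It is affine in \<open>(A, x)\<close> and in \<open>(C, y)\<close>, and \<open>x = min 1 (A / \<theta> i)\<close>
  runs through the polygonal line with vertices \<open>(0, 0)\<close>, \<open>(\<theta> i, 1)\<close>, \<open>(1, 1)\<close>.\<close>
definition vertex_val :: "nat \<Rightarrow> nat \<Rightarrow> nat \<Rightarrow> nat \<Rightarrow> real \<times> real \<Rightarrow> real \<times> real \<Rightarrow> real" where
  "vertex_val m b i j = (\<lambda>(A, x) (C, y).
     fall m (b - j) * x * (1 - C + C * (real (b - m - j) / real (b - i - j))) +
     fall m (b - i) * y * (1 - A + A * (real (b - m - i) / real (b - i - j))) +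
     2 * unif_val m b * (A * C / real (b - i - j)))"

text \<open>\<open>fall_le\<close> covers a point mass against the uniform distribution on the other
  symbols, and settles all pairs with more than \<open>b - m\<close> zeros in one argument. With at
  most \<open>b - m\<close> zeros in each, \<open>b < 2 * m\<close> leaves a symbol where both are
  positive. The conditions on \<open>\<theta> i\<close> are those of
  \<open>esym_le_mass_outside\<close> with \<open>u = m - i\<close>. If \<open>j = 0\<close>, all of
  \<open>q\<close> lies on the common support, so \<open>(1, 1)\<close> is the only vertex for
  \<open>(C, y)\<close>.\<close>

locale coll_params =
  fixes m b :: nat and \<theta> :: "nat \<Rightarrow> real"
  assumes mb: "m < b" "b < 2 * m"
    and fall_le: "fall m (b - 1) \<le> coll_bound m b"
    and \<theta>: "\<And>i. 0 < i \<Longrightarrow> i \<le> b - m \<Longrightarrow> 2 \<le> m - i \<and> 0 < \<theta> i \<and> \<theta> i < 1 \<and> real m * \<theta> i \<le> real (m - i) \<and>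
      \<theta> i * (real m ^ m * real (m - i - 1) ^ (m - i - 1)) \<le> real (m - i) ^ (m - i) * real (m - 1) ^ (m - 1)"
    and vertex_le: "\<And>i j v w. 0 < i \<Longrightarrow> i \<le> b - m \<Longrightarrow> j \<le> b - m \<Longrightarrow> v \<in> {(0, 0), (\<theta> i, 1), (1, 1)} \<Longrightarrow>
      w \<in> (if j = 0 then {(1, 1)} else {(0, 0), (\<theta> j, 1), (1, 1)}) \<Longrightarrow> vertex_val m b i j v w \<le> coll_bound m b"
begin

lemma vertex_val_le:
  assumes i: "0 < i" "i \<le> b - m" and j: "j \<le> b - m"
    and A: "0 \<le> A" "A \<le> 1" and C: "0 \<le> C" "C \<le> 1" "j = 0 \<Longrightarrow> C = 1"
  shows "vertex_val m b i j (A, min 1 (A / \<theta> i)) (C, if j = 0 then 1 else min 1 (C / \<theta> j)) \<le> coll_bound m b"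
proof -
  define y where "y = (if j = 0 then 1 else min 1 (C / \<theta> j))"
  have 1: "vertex_val m b i j v (C, y) \<le> coll_bound m b" if v: "v \<in> {(0, 0), (\<theta> i, 1), (1, 1)}" for v
  proof (cases "j = 0")
    case True
    then show ?thesis using vertex_le[OF i j v, of "(1, 1)"] C by (simp add: y_def)
  next
    case False
    obtain A x where Ax: "v = (A, x)" by (cases v)
    define r c0 c1 c2 where "r = 1 / real (b - i - j)"
      and "c0 = fall m (b - j) * x"
      and "c1 = fall m (b - j) * x * (real (b - m - j) * r - 1) + 2 * unif_val m b * A * r"
      and "c2 = fall m (b - i) * (1 - A + A * (real (b - m - i) * r))"
    have eq: "vertex_val m b i j v (C, y) = c0 + c1 * C + c2 * y" for C y
      by (simp add: vertex_val_def Ax r_def c0_def c1_def c2_def algebra_simps)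
    have w: "(0, 0) \<in> (if j = 0 then {(1, 1)} else {(0, 0), (\<theta> j, 1), (1, 1)})"
       "(\<theta> j, 1) \<in> (if j = 0 then {(1, 1)} else {(0, 0), (\<theta> j, 1), (1, 1)})"
       "(1, 1) \<in> (if j = 0 then {(1, 1)} else {(0, 0), (\<theta> j, 1), (1, 1)})" using False by auto
    show ?thesis
      using vertex_le[OF i j v w(1)] vertex_le[OF i j v w(2)] vertex_le[OF i j v w(3)] \<theta>[of j] False j C
      unfolding eq by (simp add: y_def) (rule affine_min_le, auto)
  qed
  define r c0 c1 c2 where "r = 1 / real (b - i - j)"
    and "c0 = fall m (b - i) * y"
    and "c1 = fall m (b - i) * y * (real (b - m - i) * r - 1) + 2 * unif_val m b * C * r"
    and "c2 = fall m (b - j) * (1 - C + C * (real (b - m - j) * r))"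
  have eq: "vertex_val m b i j (A, x) (C, y) = c0 + c1 * A + c2 * x" for A x
    by (simp add: vertex_val_def r_def c0_def c1_def c2_def algebra_simps)
  have "vertex_val m b i j (A, min 1 (A / \<theta> i)) (C, y) \<le> coll_bound m b"
    using 1[of "(0, 0)"] 1[of "(\<theta> i, 1)"] 1[of "(1, 1)"] \<theta>[of i] i A
    unfolding eq by (intro affine_min_le) auto
  then show ?thesis by (simp add: y_def)
qed

lemma unif_nonneg: "0 \<le> unif_val m b"
  by (simp add: unif_val_def)

lemma unif_le_bound: "2 * unif_val m b \<le> coll_bound m b"
  using unif_nonneg by (simp add: coll_bound_def algebra_simps)

lemma coll_form_le_if_zero:
  assumes I: "finite I" "card I = b" and p: "p \<in> simplex_on I" and q: "q \<in> simplex_on I"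
    and const: "\<And>i j. i \<in> I \<Longrightarrow> j \<in> I \<Longrightarrow> 0 < p i \<Longrightarrow> 0 < p j \<Longrightarrow> 0 < q i \<Longrightarrow> 0 < q j \<Longrightarrow> p i = p j \<and> q i = q j"
    and z: "\<exists>s\<in>I. q s = 0"
  shows "coll_form m (2 * unif_val m b) I p q \<le> coll_bound m b"
proof -
  note pp = simplex_onD[OF p] and qq = simplex_onD[OF q]
  have m: "0 < m" using mb by simp
  \<comment> \<open>With more than \<open>b - m\<close> zeros, \<open>q\<close> charges fewer than
    \<open>m\<close> symbols, so \<open>m\<close> distinct ones cannot be drawn from it and
    \<open>phi m I q p\<close> vanishes.\<close>
  have small: "coll_form m (2 * unif_val m b) I p q \<le> coll_bound m b"
    if p: "p \<in> simplex_on I" and q: "q \<in> simplex_on I" and c: "card {s \<in> I. q s = 0} > b - m" for p q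
  proof -
    have "card {s \<in> I. q s \<noteq> 0} + card {s \<in> I. q s = 0} = b"
    proof -
      have "{s \<in> I. q s \<noteq> 0} \<union> {s \<in> I. q s = 0} = I" by auto
      then show ?thesis using I by (subst card_Un_disjoint[symmetric]) auto
    qed
    then have "phi m I q p = 0" using c I by (intro phi_eq_0) auto
    then show ?thesis
      using phi_add_inner_le[OF I(1) m p q, of "coll_bound m b" "2 * unif_val m b"] fall_le unif_le_bound I
      by (simp add: coll_form_def)
  qed
  \<comment> \<open>Common zeros of \<open>p\<close> and \<open>q\<close> are counted in
    \<open>S2\<close>, which makes the three sets a partition; on \<open>S1\<close> both functions
    are constant by \<open>const\<close>.\<close>
  define S1 S2 S3 where "S1 = {s \<in> I. 0 < p s \<and> 0 < q s}" and "S2 = {s \<in> I. q s = 0}"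
    and "S3 = {s \<in> I. p s = 0 \<and> 0 < q s}"
  define i j where "i = card S2" and "j = card S3"
  have fin: "finite S1" "finite S2" "finite S3" using I by (auto simp: S1_def S2_def S3_def)
  have sub: "S1 \<subseteq> I" "S2 \<subseteq> I" "S3 \<subseteq> I" by (auto simp: S1_def S2_def S3_def)
  have disj: "S1 \<inter> S2 = {}" "S1 \<inter> S3 = {}" "S2 \<inter> S3 = {}" by (auto simp: S1_def S2_def S3_def)
  have un: "I - S2 = S1 \<union> S3" 
    using pp(2) qq(2) by (auto simp: S1_def S2_def S3_def order.order_iff_strict)
  have un': "I = S1 \<union> S3 \<union> S2" using un sub by auto
  show ?thesis
  proof (cases "i \<le> b - m \<and> card {s \<in> I. p s = 0} \<le> b - m")
    case False
    then consider "card {s \<in> I. q s = 0} > b - m" | "card {s \<in> I. p s = 0} > b - m"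
      by (auto simp: i_def S2_def)
    then show ?thesis
    proof cases
      case 1 then show ?thesis by (rule small[OF p q])
    next
      case 2 then show ?thesis using small[OF q p] by (simp add: coll_form_commute)
    qed
  next
    case True
    have "S3 \<subseteq> {s \<in> I. p s = 0}" by (auto simp: S3_def)
    then have "j \<le> card {s \<in> I. p s = 0}" using I by (auto simp: j_def intro: card_mono)
    then have ij: "0 < i" "i \<le> b - m" "j \<le> b - m"
      using True z fin by (auto simp: i_def S2_def card_gt_0_iff)
    have "card S1 + card S3 + card S2 = card I"
      unfolding un' using fin disj by (subst card_Un_disjoint; (subst card_Un_disjoint)?) auto
    then have n1: "card S1 = b - i - j" using I by (simp add: i_def j_def)
    then have "card S1 > 0" using ij mb by simp
    then have S1ne: "S1 \<noteq> {}" by auto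
    then obtain s0 where s0: "s0 \<in> S1" by blast
    have pc: "p s = p s0" and qc: "q s = q s0" if "s \<in> S1" for s
      using const[of s s0] that s0 by (auto simp: S1_def)
    define A C where "A = sum p S1" and "C = sum q S1"
    have pS3: "sum p S3 = 0" and qS2: "sum q S2 = 0" by (auto simp: S3_def S2_def)
    have A: "sum p (I - S2) = A" "0 \<le> A" "A \<le> 1"
    proof -
      show "sum p (I - S2) = A" unfolding un A_def using fin disj pS3 by (subst sum.union_disjoint) auto
      show "0 \<le> A" unfolding A_def using pp(2) sub by (intro sum_nonneg) auto
      have "A \<le> sum p I" unfolding A_def using pp(2) sub I by (intro sum_mono2) auto
      then show "A \<le> 1" using pp(1) by simp
    qed
    have C: "sum q (I - S3) = C" "0 \<le> C" "C \<le> 1" "j = 0 \<Longrightarrow> C = 1"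
    proof -
      have "I - S3 = S1 \<union> S2" using un' disj by auto
      then show C1: "sum q (I - S3) = C"
        unfolding C_def using fin disj qS2 by (simp add: sum.union_disjoint)
      show "0 \<le> C" unfolding C_def using qq(2) sub by (intro sum_nonneg) auto
      have "C \<le> sum q I" unfolding C_def using qq(2) sub I by (intro sum_mono2) auto
      then show "C \<le> 1" using qq(1) by simp
      show "C = 1" if "j = 0" using that C1 qq(1) fin by (simp add: j_def)
    qed
    have cI: "card (I - S3) = b - j" "card (I - S2) = b - i"
      using I sub fin by (simp_all add: card_Diff_subset i_def j_def)
    define x where "x = min 1 (A / \<theta> i)"
    define y where "y = (if j = 0 then 1 else min 1 (C / \<theta> j))"
    \<comment> \<open>The small set is \<open>S2\<close>, outside which \<open>p\<close> has mass
      \<open>A\<close>; the zeros of \<open>p\<close> in \<open>S3\<close> sharpen the Maclaurin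
      bound to \<open>b - j\<close> symbols. For \<open>q\<close> the roles of \<open>S2\<close> and
      \<open>S3\<close> are exchanged, and the plain Maclaurin bound is used when \<open>S3\<close>
      is empty.\<close>
    have hp: "fact m * esym m I p \<le> fall m (b - j) * x"
    proof -
      have "fact m * esym m I p \<le> fall m (card (I - S3)) * min 1 (sum p (I - S2) / \<theta> i)"
        using \<theta>[of i] ij I pp sub S2_def z
        by (intro esym_le_mass_outside[where u = "m - i"]) (auto simp: i_def S3_def)
      then show ?thesis by (simp add: cI A x_def)
    qed
    have hq: "fact m * esym m I q \<le> fall m (b - i) * y"
    proof (cases "j = 0")
      case True
      have "esym m I q = esym m (I - S2) q" using I by (intro esym_subset) (auto simp: S2_def)
      moreover have "sum q (I - S2) = 1"
        using qq(1) qS2 sum.subset_diff[OF sub(2) I(1), of q] by simp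
      ultimately show ?thesis
        using esym_le_fall[of "I - S2" q m] I qq(2) True cI by (simp add: y_def)
    next
      case False
      have "fact m * esym m I q \<le> fall m (card (I - S2)) * min 1 (sum q (I - S3) / \<theta> j)"
        using \<theta>[of j] ij I qq sub False
        by (intro esym_le_mass_outside[where u = "m - j"]) (auto simp: j_def S2_def)
      then show ?thesis using False by (simp add: cI C y_def)
    qed
    define r where "r = real (b - i - j)"
    have r: "0 < r" using n1 \<open>card S1 > 0\<close> by (simp add: r_def)
    have cz: "m + card S3 \<le> card I" "m + card S2 \<le> card I"
      using ij mb I by (simp_all add: i_def j_def)
    have zero: "\<And>t. t \<in> S3 \<Longrightarrow> p t = 0" "\<And>t. t \<in> S2 \<Longrightarrow> q t = 0"
      by (auto simp: S2_def S3_def)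
    have "phi m I p q \<le> fact m * esym m I p *
        (1 - sum q S1 + sum q S1 * (real (card I - m - card S3) / real (card S1)))"
    proof (rule phi_le_esym)
      show "q s = q s0" if "s \<in> S1" for s using that by (rule qc)
    qed (use I pp qq sub S1ne disj cz zero in auto)
    then have "phi m I p q \<le> fact m * esym m I p * (1 - C + C * (real (b - m - j) / r))"
      by (simp only: C_def[symmetric] n1 r_def j_def[symmetric] I(2))
    also have "\<dots> \<le> fall m (b - j) * x * (1 - C + C * (real (b - m - j) / r))"
      using C r by (intro mult_right_mono hp) auto
    finally have 1: "phi m I p q \<le> fall m (b - j) * x * (1 - C + C * (real (b - m - j) / r))" .
    have "phi m I q p \<le> fact m * esym m I q *
        (1 - sum p S1 + sum p S1 * (real (card I - m - card S2) / real (card S1)))"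
    proof (rule phi_le_esym)
      show "p s = p s0" if "s \<in> S1" for s using that by (rule pc)
    qed (use I pp qq sub S1ne disj cz zero in auto)
    then have "phi m I q p \<le> fact m * esym m I q * (1 - A + A * (real (b - m - i) / r))"
      by (simp only: A_def[symmetric] n1 r_def i_def[symmetric] I(2))
    also have "\<dots> \<le> fall m (b - i) * y * (1 - A + A * (real (b - m - i) / r))"
      using A r by (intro mult_right_mono hq) auto
    finally have 2: "phi m I q p \<le> fall m (b - i) * y * (1 - A + A * (real (b - m - i) / r))" .
    have "(\<Sum>s\<in>I. p s * q s) = (\<Sum>s\<in>S1. p s * q s)"
      using I sub pp qq by (intro sum.mono_neutral_right) (auto simp: S1_def order.order_iff_strict)
    also have "\<dots> = (\<Sum>s\<in>S1. p s0 * q s0)" by (intro sum.cong refl) (metis pc qc)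
    also have "\<dots> = A * C / r"
    proof -
      have "A = (\<Sum>s\<in>S1. p s0)" "C = (\<Sum>s\<in>S1. q s0)"
        unfolding A_def C_def by (intro sum.cong refl pc qc; assumption)+
      then have "A = r * p s0" "C = r * q s0" using n1 by (simp_all add: r_def)
      then show ?thesis using r n1 by (simp add: r_def)
    qed
    finally have 3: "(\<Sum>s\<in>I. p s * q s) = A * C / r" .
    have "coll_form m (2 * unif_val m b) I p q \<le> vertex_val m b i j (A, x) (C, y)"
      using 1 2 unfolding coll_form_def 3 vertex_val_def r_def by simp
    also have "\<dots> \<le> coll_bound m b"
      unfolding x_def y_def using vertex_val_le[OF ij A(2,3) C(2-4)] .
    finally show ?thesis .
  qed
qed

lemma coll_form_le:
  assumes I: "finite I" "card I = b" and p: "p \<in> simplex_on I" and q: "q \<in> simplex_on I"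
  shows "coll_form m (2 * unif_val m b) I p q \<le> coll_bound m b"
proof -
  have "I \<noteq> {}" "2 \<le> m" using I mb by auto
  then obtain p0 q0 where p0: "p0 \<in> simplex_on I" and q0: "q0 \<in> simplex_on I"
    and max: "\<And>p' q'. p' \<in> simplex_on I \<Longrightarrow> q' \<in> simplex_on I \<Longrightarrow>
        coll_form m (2 * unif_val m b) I p' q' \<le> coll_form m (2 * unif_val m b) I p0 q0"
    and const: "\<And>i j. i \<in> I \<Longrightarrow> j \<in> I \<Longrightarrow> 0 < p0 i \<Longrightarrow> 0 < p0 j \<Longrightarrow> 0 < q0 i \<Longrightarrow> 0 < q0 j \<Longrightarrow> p0 i = p0 j \<and> q0 i = q0 j"
    using coll_form_maximizer[OF I(1), where m = m and \<kappa> = "2 * unif_val m b"] by blast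
  have "coll_form m (2 * unif_val m b) I p0 q0 \<le> coll_bound m b"
  proof -
    consider "\<exists>s\<in>I. q0 s = 0" | "\<exists>s\<in>I. p0 s = 0" | "\<forall>s\<in>I. q0 s \<noteq> 0 \<and> p0 s \<noteq> 0" by blast
    then show ?thesis
    proof cases
      case 1
      then show ?thesis using coll_form_le_if_zero[OF I p0 q0 const] by blast
    next
      case 2
      have "coll_form m (2 * unif_val m b) I q0 p0 \<le> coll_bound m b"
        using coll_form_le_if_zero[OF I q0 p0] const 2 by blast
      then show ?thesis by (simp add: coll_form_commute)
    next
      case 3
      have pos: "0 < p0 s" "0 < q0 s" if "s \<in> I" for s
        using 3 that simplex_onD(2)[OF p0] simplex_onD(2)[OF q0] by (auto simp: order.order_iff_strict)
      obtain s0 where s0: "s0 \<in> I" using \<open>I \<noteq> {}\<close> by blast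
      have pc: "p0 s = p0 s0" and qc: "q0 s = q0 s0" if "s \<in> I" for s
        using const[of s s0] pos s0 that by auto
      have "sum p0 I = real b * p0 s0" "sum q0 I = real b * q0 s0"
        using pc qc I by simp_all
      then have v: "p0 s0 = 1 / real b" "q0 s0 = 1 / real b"
        using simplex_onD(1)[OF p0] simplex_onD(1)[OF q0] mb by (auto simp: field_simps)
      have phi: "phi m I f g \<le> unif_val m b"
        if f: "\<And>s. s \<in> I \<Longrightarrow> f s = 1 / real b" and g: "sum g I = 1" "\<And>s. s \<in> I \<Longrightarrow> 0 \<le> g s" for f g :: "'a \<Rightarrow> real"
      proof -
        have "fact m * esym m (I - {s}) f \<le> unif_val m b" if s: "s \<in> I" for s
        proof -
          have "esym m (I - {s}) f = (\<Sum>T | T \<subseteq> I - {s} \<and> card T = m. (1 / real b) ^ m)"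
            unfolding esym_def using f by (intro sum.cong refl) (auto simp: subset_iff)
          also have "\<dots> = real (b - 1 choose m) * (1 / real b) ^ m"
            using s I n_subsets[of "I - {s}" m] by simp
          finally show ?thesis by (simp add: unif_val_def power_divide)
        qed
        then have "(\<Sum>s\<in>I. g s * (fact m * esym m (I - {s}) f)) \<le> (\<Sum>s\<in>I. g s * unif_val m b)"
          using g by (intro sum_mono mult_left_mono) auto
        then show ?thesis
          using g(1) by (simp add: phi_def sum_distrib_left sum_distrib_right[symmetric] mult.left_commute)
      qed
      have eq: "p0 s = 1 / real b" "q0 s = 1 / real b" if "s \<in> I" for s
        using pc[OF that] qc[OF that] v by simp_all
      have "phi m I p0 q0 \<le> unif_val m b" "phi m I q0 p0 \<le> unif_val m b"
        by (intro phi eq simplex_onD(1)[OF q0] simplex_onD(2)[OF q0] simplex_onD(1)[OF p0] simplex_onD(2)[OF p0]; assumption)+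
      moreover have "(\<Sum>s\<in>I. p0 s * q0 s) = 1 / real b"
      proof -
        have "(\<Sum>s\<in>I. p0 s * q0 s) = (\<Sum>s\<in>I. (1 / real b) * (1 / real b))"
          by (intro sum.cong refl) (simp add: eq)
        then show ?thesis using I mb by simp
      qed
      ultimately show ?thesis
        by (simp add: coll_form_def coll_bound_def algebra_simps)
    qed
  qed
  then show ?thesis using max[OF p q] by linarith
qed

text \<open>Linearity of \<open>phi\<close> in its last argument turns the left side into a double
  average of \<open>phi m I (f w) (f v)\<close>, which can be symmetrised. Averaging
  \<open>coll_form_le\<close> adds \<open>2 * F\<close> times the sum of squares of
  \<open>g\<close>; being at least \<open>2 * F / b\<close>, this cancels the surplus in
  \<open>coll_bound m b\<close>.\<close>

lemma sum_phi_mixture_le: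
  assumes I: "finite I" "card I = b" and W: "finite W"
    and l: "\<And>w. w \<in> W \<Longrightarrow> 0 \<le> l w" "sum l W = 1"
    and f: "\<And>w. w \<in> W \<Longrightarrow> f w \<in> simplex_on I"
    and g: "\<And>s. s \<in> I \<Longrightarrow> g s = (\<Sum>w\<in>W. l w * f w s)"
  shows "(\<Sum>w\<in>W. l w * phi m I (f w) g) \<le> unif_val m b"
proof -
  define F where "F = unif_val m b"
  have phi_g: "phi m I p g = (\<Sum>w\<in>W. l w * phi m I p (f w))" for p
  proof -
    have "(\<Sum>s\<in>I. g s * esym m (I - {s}) p) = (\<Sum>s\<in>I. \<Sum>w\<in>W. l w * (f w s * esym m (I - {s}) p))"
      using g by (intro sum.cong refl) (simp add: sum_distrib_right mult.assoc)
    also have "\<dots> = (\<Sum>w\<in>W. \<Sum>s\<in>I. l w * (f w s * esym m (I - {s}) p))" by (rule sum.swap)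
    finally show ?thesis
      by (simp add: phi_def sum_distrib_left mult.left_commute)
  qed
  define X where "X = (\<Sum>w\<in>W. l w * phi m I (f w) g)"
  have X1: "X = (\<Sum>w\<in>W. \<Sum>v\<in>W. l w * l v * phi m I (f w) (f v))"
    by (simp add: X_def phi_g sum_distrib_left mult.assoc)
  have X2: "X = (\<Sum>w\<in>W. \<Sum>v\<in>W. l w * l v * phi m I (f v) (f w))"
    unfolding X1 by (subst sum.swap) (simp add: mult.commute)
  have gg: "(\<Sum>w\<in>W. \<Sum>v\<in>W. l w * l v * (\<Sum>s\<in>I. f w s * f v s)) = (\<Sum>s\<in>I. (g s)\<^sup>2)"
  proof -
    have "(\<Sum>s\<in>I. (g s)\<^sup>2) = (\<Sum>s\<in>I. \<Sum>w\<in>W. \<Sum>v\<in>W. l w * l v * (f w s * f v s))"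
      using g by (intro sum.cong refl) (simp add: power2_eq_square sum_product mult_ac)
    also have "\<dots> = (\<Sum>w\<in>W. \<Sum>s\<in>I. \<Sum>v\<in>W. l w * l v * (f w s * f v s))" by (rule sum.swap)
    also have "\<dots> = (\<Sum>w\<in>W. \<Sum>v\<in>W. \<Sum>s\<in>I. l w * l v * (f w s * f v s))"
      by (intro sum.cong refl sum.swap)
    finally show ?thesis by (simp add: sum_distrib_left)
  qed
  have ll: "(\<Sum>w\<in>W. \<Sum>v\<in>W. l w * l v * c) = c" for c :: real
  proof -
    have "(\<Sum>w\<in>W. \<Sum>v\<in>W. l w * l v * c) = (\<Sum>w\<in>W. l w * (sum l W * c))"
      by (simp add: sum_distrib_left sum_distrib_right mult.assoc)
    then show ?thesis using l(2) by (simp flip: sum_distrib_right)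
  qed
  have sg: "sum g I = 1"
  proof -
    have "sum g I = (\<Sum>s\<in>I. \<Sum>w\<in>W. l w * f w s)" using g by (intro sum.cong) auto
    also have "\<dots> = (\<Sum>w\<in>W. \<Sum>s\<in>I. l w * f w s)" by (rule sum.swap)
    also have "\<dots> = (\<Sum>w\<in>W. l w * 1)"
      using f by (intro sum.cong refl) (simp add: sum_distrib_left[symmetric] simplex_onD(1))
    finally show ?thesis using l(2) by simp
  qed
  have "1 / real b \<le> (\<Sum>s\<in>I. (g s)\<^sup>2)"
  proof -
    have "0 \<le> (\<Sum>s\<in>I. (g s - 1 / real b)\<^sup>2)" by (intro sum_nonneg) auto
    also have "\<dots> = (\<Sum>s\<in>I. (g s)\<^sup>2) - 2 / real b * sum g I + real b * (1 / real b)\<^sup>2"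
      using I by (simp add: power2_diff sum.distrib sum_subtractf mult_ac flip: sum_divide_distrib sum_distrib_right)
    also have "\<dots> = (\<Sum>s\<in>I. (g s)\<^sup>2) - 1 / real b"
      using mb by (simp add: sg power2_eq_square)
    finally show ?thesis by simp
  qed
  then have "2 * F * (1 / real b) \<le> 2 * F * (\<Sum>s\<in>I. (g s)\<^sup>2)"
    using unif_nonneg by (intro mult_left_mono) (auto simp: F_def)
  moreover have "2 * X + 2 * F * (\<Sum>s\<in>I. (g s)\<^sup>2) =
     (\<Sum>w\<in>W. \<Sum>v\<in>W. l w * l v * coll_form m (2 * F) I (f w) (f v))"
  proof -
    have "2 * X + 2 * F * (\<Sum>s\<in>I. (g s)\<^sup>2) = X + X + 2 * F * (\<Sum>s\<in>I. (g s)\<^sup>2)" by simp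
    also have "\<dots> = (\<Sum>w\<in>W. \<Sum>v\<in>W. l w * l v * phi m I (f w) (f v)) +
       (\<Sum>w\<in>W. \<Sum>v\<in>W. l w * l v * phi m I (f v) (f w)) +
       2 * F * (\<Sum>w\<in>W. \<Sum>v\<in>W. l w * l v * (\<Sum>s\<in>I. f w s * f v s))"
      using X1 X2 gg by presburger
    also have "\<dots> = (\<Sum>w\<in>W. \<Sum>v\<in>W. l w * l v * phi m I (f w) (f v) + l w * l v * phi m I (f v) (f w) +
        2 * F * (l w * l v * (\<Sum>s\<in>I. f w s * f v s)))"
      by (simp only: sum.distrib sum_distrib_left)
    also have "\<dots> = (\<Sum>w\<in>W. \<Sum>v\<in>W. l w * l v * coll_form m (2 * F) I (f w) (f v))"
      by (intro sum.cong refl) (simp add: coll_form_def algebra_simps)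
    finally show ?thesis .
  qed
  moreover have "\<dots> \<le> (\<Sum>w\<in>W. \<Sum>v\<in>W. l w * l v * coll_bound m b)"
    unfolding F_def using l f I by (intro sum_mono mult_left_mono coll_form_le mult_nonneg_nonneg) auto
  ultimately have "2 * X + 2 * F * (1 / real b) \<le> coll_bound m b" unfolding ll by linarith
  then show ?thesis by (simp add: X_def coll_bound_def F_def algebra_simps)
qed

end

text \<open>Rational numbers slightly below the largest \<open>\<theta>\<close> allowed by
  \<open>esym_le_mass_outside\<close> when the small set has \<open>i\<close> elements,
  in the cases needed below\<close>
definition weight_thresh :: "nat \<Rightarrow> real" where
  "weight_thresh i = (if i = 1 then 3 / 4 else if i = 2 then 11 / 20 else 9 / 20)"

section \<open>Exact values and the numerical conditions for the five parameter pairs\<close>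

lemma fall_values:
  "fall 5 7 = 360 / 2401"
  "fall 5 6 = 5 / 54"
  "fall 5 5 = 24 / 625"
  "fall 6 8 = 315 / 4096"
  "fall 6 7 = 720 / 16807"
  "fall 6 6 = 5 / 324"
  "fall 6 9 = 2240 / 19683"
  "fall 7 10 = 189 / 3125"
  "fall 7 9 = 2240 / 59049"
  "fall 7 8 = 315 / 16384"
  "fall 7 7 = 720 / 117649"
  "fall 8 11 = 604800 / 19487171"
  "fall 8 10 = 567 / 31250"
  "fall 8 9 = 4480 / 531441"
  "fall 8 8 = 315 / 131072"
  by (simp_all add: fall_def fact_numeral eval_nat_numeral)

lemma unif_values:
  "unif_val 5 7 = 720 / 16807"
  "unif_val 6 8 = 315 / 16384"
  "unif_val 6 9 = 2240 / 59049"
  "unif_val 7 10 = 567 / 31250"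
  "unif_val 8 11 = 1814400 / 214358881"
  by (simp_all add: unif_val_def fact_numeral eval_nat_numeral)

lemma coll_params_7_7: "coll_params 5 7 weight_thresh"
proof
  fix i j :: nat and v w :: "real \<times> real"
  assume "0 < i" "i \<le> 7 - 5"
  then have i: "i = 1 \<or> i = 2" by auto
  then show "2 \<le> 5 - i \<and> 0 < weight_thresh i \<and> weight_thresh i < 1 \<and>
      real 5 * weight_thresh i \<le> real (5 - i) \<and>
      weight_thresh i * (real 5 ^ 5 * real (5 - i - 1) ^ (5 - i - 1)) \<le>
      real (5 - i) ^ (5 - i) * real (5 - 1) ^ (5 - 1)"
    by (auto simp: weight_thresh_def)
  assume "j \<le> 7 - 5"
  then have j: "j = 0 \<or> j = 1 \<or> j = 2" by auto
  assume "v \<in> {(0, 0), (weight_thresh i, 1), (1, 1)}"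
    "w \<in> (if j = 0 then {(1, 1)} else {(0, 0), (weight_thresh j, 1), (1, 1)})"
  with i j show "vertex_val 5 7 i j v w \<le> coll_bound 5 7"
    by (auto simp: vertex_val_def coll_bound_def unif_values fall_values weight_thresh_def split: if_splits)
qed (simp_all add: coll_bound_def unif_values fall_values)

lemma coll_params_8_8: "coll_params 6 8 weight_thresh"
proof
  fix i j :: nat and v w :: "real \<times> real"
  assume "0 < i" "i \<le> 8 - 6"
  then have i: "i = 1 \<or> i = 2" by auto
  then show "2 \<le> 6 - i \<and> 0 < weight_thresh i \<and> weight_thresh i < 1 \<and>
      real 6 * weight_thresh i \<le> real (6 - i) \<and>
      weight_thresh i * (real 6 ^ 6 * real (6 - i - 1) ^ (6 - i - 1)) \<le>
      real (6 - i) ^ (6 - i) * real (6 - 1) ^ (6 - 1)"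
    by (auto simp: weight_thresh_def)
  assume "j \<le> 8 - 6"
  then have j: "j = 0 \<or> j = 1 \<or> j = 2" by auto
  assume "v \<in> {(0, 0), (weight_thresh i, 1), (1, 1)}"
    "w \<in> (if j = 0 then {(1, 1)} else {(0, 0), (weight_thresh j, 1), (1, 1)})"
  with i j show "vertex_val 6 8 i j v w \<le> coll_bound 6 8"
    by (auto simp: vertex_val_def coll_bound_def unif_values fall_values weight_thresh_def split: if_splits)
qed (simp_all add: coll_bound_def unif_values fall_values)

lemma coll_params_9_8: "coll_params 6 9 weight_thresh"
proof
  fix i j :: nat and v w :: "real \<times> real"
  assume "0 < i" "i \<le> 9 - 6"
  then have i: "i = 1 \<or> i = 2 \<or> i = 3" by auto
  then show "2 \<le> 6 - i \<and> 0 < weight_thresh i \<and> weight_thresh i < 1 \<and>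
      real 6 * weight_thresh i \<le> real (6 - i) \<and>
      weight_thresh i * (real 6 ^ 6 * real (6 - i - 1) ^ (6 - i - 1)) \<le>
      real (6 - i) ^ (6 - i) * real (6 - 1) ^ (6 - 1)"
    by (auto simp: weight_thresh_def)
  assume "j \<le> 9 - 6"
  then have j: "j = 0 \<or> j = 1 \<or> j = 2 \<or> j = 3" by auto
  assume "v \<in> {(0, 0), (weight_thresh i, 1), (1, 1)}"
    "w \<in> (if j = 0 then {(1, 1)} else {(0, 0), (weight_thresh j, 1), (1, 1)})"
  with i j show "vertex_val 6 9 i j v w \<le> coll_bound 6 9"
    by (auto simp: vertex_val_def coll_bound_def unif_values fall_values weight_thresh_def split: if_splits)
qed (simp_all add: coll_bound_def unif_values fall_values)

lemma coll_params_10_9: "coll_params 7 10 weight_thresh"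
proof
  fix i j :: nat and v w :: "real \<times> real"
  assume "0 < i" "i \<le> 10 - 7"
  then have i: "i = 1 \<or> i = 2 \<or> i = 3" by auto
  then show "2 \<le> 7 - i \<and> 0 < weight_thresh i \<and> weight_thresh i < 1 \<and>
      real 7 * weight_thresh i \<le> real (7 - i) \<and>
      weight_thresh i * (real 7 ^ 7 * real (7 - i - 1) ^ (7 - i - 1)) \<le>
      real (7 - i) ^ (7 - i) * real (7 - 1) ^ (7 - 1)"
    by (auto simp: weight_thresh_def)
  assume "j \<le> 10 - 7"
  then have j: "j = 0 \<or> j = 1 \<or> j = 2 \<or> j = 3" by auto
  assume "v \<in> {(0, 0), (weight_thresh i, 1), (1, 1)}"
    "w \<in> (if j = 0 then {(1, 1)} else {(0, 0), (weight_thresh j, 1), (1, 1)})"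
  with i j show "vertex_val 7 10 i j v w \<le> coll_bound 7 10"
    by (auto simp: vertex_val_def coll_bound_def unif_values fall_values weight_thresh_def split: if_splits)
qed (simp_all add: coll_bound_def unif_values fall_values)

lemma coll_params_11_10: "coll_params 8 11 weight_thresh"
proof
  fix i j :: nat and v w :: "real \<times> real"
  assume "0 < i" "i \<le> 11 - 8"
  then have i: "i = 1 \<or> i = 2 \<or> i = 3" by auto
  then show "2 \<le> 8 - i \<and> 0 < weight_thresh i \<and> weight_thresh i < 1 \<and>
      real 8 * weight_thresh i \<le> real (8 - i) \<and>
      weight_thresh i * (real 8 ^ 8 * real (8 - i - 1) ^ (8 - i - 1)) \<le>
      real (8 - i) ^ (8 - i) * real (8 - 1) ^ (8 - 1)"
    by (auto simp: weight_thresh_def)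
  assume "j \<le> 11 - 8"
  then have j: "j = 0 \<or> j = 1 \<or> j = 2 \<or> j = 3" by auto
  assume "v \<in> {(0, 0), (weight_thresh i, 1), (1, 1)}"
    "w \<in> (if j = 0 then {(1, 1)} else {(0, 0), (weight_thresh j, 1), (1, 1)})"
  with i j show "vertex_val 8 11 i j v w \<le> coll_bound 8 11"
    by (auto simp: vertex_val_def coll_bound_def unif_values fall_values weight_thresh_def split: if_splits)
qed (simp_all add: coll_bound_def unif_values fall_values)

section \<open>Hash codes\<close>

lemma finite_words: "finite (words b n)"
  by (auto simp: words_def intro: finite_PiE)

lemma words_D: "c \<in> words b n \<Longrightarrow> i < n \<Longrightarrow> c i \<in> {1..b}"
  by (auto simp: words_def)

text \<open>A set mapped injectively onto \<open>T\<close> picks one element from each fibre over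
  \<open>T\<close>, so the number of such sets is at most the product of the fibre sizes.\<close>

lemma card_transversals_le:
  assumes "finite Y" "finite J"
  shows "card {X. X \<subseteq> Y \<and> card X = m \<and> inj_on f X \<and> f ` X \<subseteq> J}
    \<le> esym m J (\<lambda>t. real (card {c \<in> Y. f c = t}))"
proof -
  define U where "U T = {X. X \<subseteq> Y \<and> inj_on f X \<and> f ` X = T}" for T
  have finU: "finite (U T)" for T using assms by (auto simp: U_def intro: finite_subset[of _ "Pow Y"])
  have cU: "card (U T) \<le> (\<Prod>t\<in>T. card {c \<in> Y. f c = t})" if "finite T" for T
  proof -
    have "U T \<subseteq> (\<lambda>g. g ` T) ` (PiE T (\<lambda>t. {c \<in> Y. f c = t}))"
    proof
      fix X assume X: "X \<in> U T"
      define g where "g = (\<lambda>t\<in>T. inv_into X f t)"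
      have "g ` T = X" "g \<in> PiE T (\<lambda>t. {c \<in> Y. f c = t})"
        using X by (auto simp: g_def U_def image_iff f_inv_into_f inv_into_into intro!: bexI)
      then show "X \<in> (\<lambda>g. g ` T) ` (PiE T (\<lambda>t. {c \<in> Y. f c = t}))" by blast
    qed
    moreover have fin: "finite (PiE T (\<lambda>t. {c \<in> Y. f c = t}))"
      using that assms by (intro finite_PiE) auto
    ultimately have "card (U T) \<le> card ((\<lambda>g. g ` T) ` (PiE T (\<lambda>t. {c \<in> Y. f c = t})))"
      by (intro card_mono) auto
    also have "\<dots> \<le> card (PiE T (\<lambda>t. {c \<in> Y. f c = t}))" by (rule card_image_le[OF fin])
    finally show ?thesis using that by (simp add: card_PiE)
  qed
  define S where "S = {T. T \<subseteq> J \<and> card T = m}"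
  have "finite S" using assms by (simp add: S_def)
  have "{X. X \<subseteq> Y \<and> card X = m \<and> inj_on f X \<and> f ` X \<subseteq> J} \<subseteq> (\<Union>T\<in>S. U T)"
    by (auto simp: S_def U_def card_image)
  then have "card {X. X \<subseteq> Y \<and> card X = m \<and> inj_on f X \<and> f ` X \<subseteq> J} \<le> card (\<Union>T\<in>S. U T)"
    using \<open>finite S\<close> finU by (intro card_mono) auto
  also have "\<dots> \<le> (\<Sum>T\<in>S. card (U T))" by (rule card_UN_le[OF \<open>finite S\<close>])
  also have "\<dots> \<le> (\<Sum>T\<in>S. \<Prod>t\<in>T. card {c \<in> Y. f c = t})"
    using assms finite_subset by (intro sum_mono cU) (auto simp: S_def)
  finally show ?thesis unfolding esym_def S_def[symmetric] by (simp flip: of_nat_prod of_nat_sum)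
qed

text \<open>Each factor \<open>K - i\<close> is at least \<open>K - m\<close>, and Bernoulli's
  inequality finishes; for \<open>K < m\<close> the left side is not positive. With \<open>K\<close>
  the size of a subcode, this bounds the loss from requiring \<open>m\<close> independent draws to
  be distinct.\<close>

lemma fall_ge: "1 - real (m\<^sup>2) / real K \<le> fall m K" if "0 < K"
proof (cases "m \<le> K")
  case False
  then have "1 \<le> real (m\<^sup>2) / real K"
    using that by (simp add: field_simps power2_eq_square flip: of_nat_mult) (metis le_square less_imp_le order_trans nat_le_linear)
  then show ?thesis using fall_nonneg[of m K] by linarith
next
  case True
  have "real (K choose m) * fact m = (\<Prod>i = 0..<m. real K - real i)"
    using gbinomial_mult_fact[of m "real K"] by (simp add: binomial_gbinomial mult.commute)
  also have "\<dots> \<ge> (\<Prod>i = 0..<m. real K - real m)"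
    using True by (intro prod_mono) auto
  finally have "(real K - real m) ^ m / real K ^ m \<le> fall m K"
    by (simp add: fall_def divide_right_mono mult.commute)
  moreover have "(real K - real m) ^ m / real K ^ m = (1 + (- (real m / real K))) ^ m"
    using that by (simp add: power_divide[symmetric] diff_divide_distrib)
  moreover have "1 + real m * (- (real m / real K)) \<le> (1 + (- (real m / real K))) ^ m"
    using True that by (intro Bernoulli_inequality) auto
  ultimately show ?thesis by (simp add: power2_eq_square)
qed

text \<open>Hansel's lemma for the graphs in which two words are adjacent at coordinate \<open>i\<close> if together with \<open>X\<close>
  they have distinct symbols there: a random symbol outside \<open>X\<close> is kept at each coordinate, and at most
  one word can survive at all coordinates.\<close>
lemma hansel:
  assumes code: "is_hash_code b (Suc (Suc m)) n C" and X: "X \<subseteq> C" "card X = m" and mb: "m < b"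
    and V: "m < card C"
  shows "real (card (C - X)) * ln (real (card (C - X))) \<le>
     ln (real (b - m)) * (\<Sum>v\<in>C - X. real (card {i \<in> {0..<n}. inj_on (\<lambda>c. c i) (insert v X)}))"
proof -
  have CW: "C \<subseteq> words b n" using code by (simp add: is_hash_code_def)
  have finC: "finite C" using finite_subset[OF CW finite_words] .
  have finX: "finite X" using finite_subset[OF X(1) finC] .
  define D where "D = b - m"
  define I where "I = {i \<in> {0..<n}. inj_on (\<lambda>c. c i) X}"
  define B where "B i = {1..b} - (\<lambda>c. c i) ` X" for i
  define d where "d v = card {i \<in> {0..<n}. inj_on (\<lambda>c. c i) (insert v X)}" for v
  \<comment> \<open>The symbol choices under which \<open>v\<close> survives: nothing is required
    where \<open>v\<close> shares a symbol with \<open>X\<close>, and elsewhere the kept symbol must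
    be \<open>v i\<close>. Coordinates where \<open>X\<close> itself collides are left out.\<close>
  define S where "S v = PiE I (\<lambda>i. if v i \<in> (\<lambda>c. c i) ` X then B i else {v i})" for v
  have finI: "finite I" by (simp add: I_def)
  have cB: "card (B i) = D" if "i \<in> I" for i
  proof -
    have "(\<lambda>c. c i) ` X \<subseteq> {1..b}" using that X CW words_D by (fastforce simp: I_def)
    moreover have "card ((\<lambda>c. c i) ` X) = m" using that X by (simp add: I_def card_image)
    ultimately show ?thesis using finX by (simp add: B_def D_def card_Diff_subset)
  qed
  have I_iff: "inj_on (\<lambda>c. c i) (insert v X) \<longleftrightarrow> inj_on (\<lambda>c. c i) X \<and> v i \<notin> (\<lambda>c. c i) ` X"
    if "v \<in> C - X" for v i
    using that by (simp add: Diff_insert_absorb)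
  have d_eq: "d v + card {i \<in> I. v i \<in> (\<lambda>c. c i) ` X} = card I" if "v \<in> C - X" for v
  proof -
    have "{i \<in> {0..<n}. inj_on (\<lambda>c. c i) (insert v X)} = {i \<in> I. v i \<notin> (\<lambda>c. c i) ` X}"
      using I_iff[OF that] by (auto simp: I_def)
    moreover have "card {i \<in> I. v i \<notin> (\<lambda>c. c i) ` X} + card {i \<in> I. v i \<in> (\<lambda>c. c i) ` X} = card I"
    proof -
      have "{i \<in> I. v i \<notin> (\<lambda>c. c i) ` X} = I - {i \<in> I. v i \<in> (\<lambda>c. c i) ` X}" by auto
      moreover have "card {i \<in> I. v i \<in> (\<lambda>c. c i) ` X} \<le> card I" using finI by (intro card_mono) auto
      ultimately show ?thesis using finI by (simp add: card_Diff_subset)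
    qed
    ultimately show ?thesis by (simp add: d_def)
  qed
  have cS: "card (S v) = D ^ (card I - d v)" if v: "v \<in> C - X" for v
  proof -
    have "card (S v) = (\<Prod>i\<in>I. card (if v i \<in> (\<lambda>c. c i) ` X then B i else {v i}))"
      unfolding S_def by (rule card_PiE[OF finI])
    also have "\<dots> = (\<Prod>i\<in>I. if v i \<in> (\<lambda>c. c i) ` X then D else 1)"
      using cB by (intro prod.cong refl) simp
    also have "\<dots> = D ^ card {i \<in> I. v i \<in> (\<lambda>c. c i) ` X}"
      using finI by (subst prod.If_cases) (auto simp: Int_def)
    also have "card {i \<in> I. v i \<in> (\<lambda>c. c i) ` X} = card I - d v" using d_eq[OF v] by simp
    finally show ?thesis .
  qed
  \<comment> \<open>At a coordinate separating \<open>v\<close>, \<open>u\<close> and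
    \<open>X\<close>, a common choice would have to equal both \<open>v i\<close> and
    \<open>u i\<close>.\<close>
  have disj: "S v \<inter> S u = {}" if v: "v \<in> C - X" and u: "u \<in> C - X" and ne: "v \<noteq> u" for u v
  proof (rule ccontr)
    assume "S v \<inter> S u \<noteq> {}"
    then obtain g where g: "g \<in> S v" "g \<in> S u" by auto
    have "card (insert v (insert u X)) = Suc (Suc m)" using u v ne finX X by simp
    moreover have "insert v (insert u X) \<subseteq> C" using u v X by auto
    ultimately obtain i where i: "i \<in> {0..<n}" "inj_on (\<lambda>c. c i) (insert v (insert u X))"
      using code unfolding is_hash_code_def by metis
    have "i \<in> I" using i inj_on_subset[OF i(2), of X] by (auto simp: I_def)
    moreover have "v i \<notin> (\<lambda>c. c i) ` X" "u i \<notin> (\<lambda>c. c i) ` X" "v i \<noteq> u i"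
      using i(2) u v ne by (auto simp: inj_on_def)
    moreover have "g i \<in> (if v i \<in> (\<lambda>c. c i) ` X then B i else {v i})"
      "g i \<in> (if u i \<in> (\<lambda>c. c i) ` X then B i else {u i})"
      using PiE_mem[OF g(1)[unfolded S_def] \<open>i \<in> I\<close>] PiE_mem[OF g(2)[unfolded S_def] \<open>i \<in> I\<close>] by blast+
    ultimately show False by simp
  qed
  have "(\<Sum>v\<in>C - X. card (S v)) = card (\<Union>v\<in>C - X. S v)"
    using finC disj finI by (intro card_UN_disjoint[symmetric]) (auto simp: S_def B_def intro!: finite_PiE)
  also have "\<dots> \<le> card (PiE I B)"
  proof (rule card_mono)
    show "finite (PiE I B)" using finI by (auto simp: B_def intro: finite_PiE)
    show "(\<Union>v\<in>C - X. S v) \<subseteq> PiE I B"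
    proof (intro UN_least)
      fix v assume v: "v \<in> C - X"
      have "v i \<in> {1..b}" if "i \<in> I" for i
        using words_D[of v b n i] v CW that by (auto simp: I_def)
      then show "S v \<subseteq> PiE I B"
        unfolding S_def by (intro PiE_mono) (auto simp: B_def)
    qed
  qed
  also have "\<dots> = D ^ card I" using finI cB by (simp add: card_PiE)
  finally have sumle: "(\<Sum>v\<in>C - X. D ^ (card I - d v)) \<le> D ^ card I" using cS by simp
  define L where "L = ln (real D)"
  define N where "N = real (card (C - X))"
  define a where "a = (\<Sum>v\<in>C - X. real (d v)) / N"
  have "card (C - X) = card C - m" using X finX by (simp add: card_Diff_subset)
  then have N: "0 < N" using V by (simp add: N_def)
  have D: "0 < real D" using mb by (simp add: D_def)
  have pw: "real D ^ k = exp (L * real k)" for k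
    using D exp_of_nat_mult[of k "ln (real D)"] by (simp add: L_def mult.commute)
  \<comment> \<open>Jensen's inequality for \<open>exp\<close>, through the tangent line at the mean
    \<open>a\<close> of the \<open>d v\<close>.\<close>
  have "N * exp (L * (real (card I) - a)) = (\<Sum>v\<in>C - X. exp (L * (real (card I) - a)) * (1 + L * (a - real (d v))))"
  proof -
    have "(\<Sum>v\<in>C - X. 1 + L * (a - real (d v))) = N + L * (N * a - (\<Sum>v\<in>C - X. real (d v)))"
      by (simp add: sum.distrib sum_subtractf sum_distrib_left[symmetric] N_def)
    also have "N * a = (\<Sum>v\<in>C - X. real (d v))" using N by (simp add: a_def)
    finally show ?thesis by (simp add: sum_distrib_left[symmetric] mult.commute)
  qed
  also have "\<dots> \<le> (\<Sum>v\<in>C - X. exp (L * (real (card I) - a)) * exp (L * (a - real (d v))))"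
    by (intro sum_mono mult_left_mono exp_ge_add_one_self) auto
  also have "\<dots> = (\<Sum>v\<in>C - X. real D ^ (card I - d v))"
  proof (rule sum.cong[OF refl])
    fix v assume "v \<in> C - X"
    then have "d v \<le> card I" using d_eq by fastforce
    then show "exp (L * (real (card I) - a)) * exp (L * (a - real (d v))) = real D ^ (card I - d v)"
      unfolding pw exp_add[symmetric] by (simp add: of_nat_diff algebra_simps)
  qed
  also have "\<dots> \<le> real D ^ card I" using sumle by (simp flip: of_nat_power of_nat_sum)
  also have "\<dots> = exp (L * a) * exp (L * (real (card I) - a))"
    unfolding pw exp_add[symmetric] by (simp add: algebra_simps)
  finally have "N \<le> exp (L * a)" by simp
  then have "ln N \<le> L * a" using N by (metis ln_exp ln_le_cancel_iff exp_gt_zero)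
  then have "N * ln N \<le> N * (L * a)" using N by simp
  also have "N * (L * a) = L * (\<Sum>v\<in>C - X. real (d v))" using N by (simp add: a_def)
  finally show ?thesis by (simp add: N_def L_def D_def d_def)
qed

text \<open>Restricted to \<open>{1..b}\<close> because \<open>simplex_on\<close> asks for
  extensional functions.\<close>

definition freq :: "nat \<Rightarrow> (nat \<Rightarrow> nat) set \<Rightarrow> nat \<Rightarrow> nat \<Rightarrow> real" where
  "freq b Y i = (\<lambda>s\<in>{1..b}. real (card {c \<in> Y. c i = s}) / real (card Y))"

lemma sum_by_symbol:
  assumes "Y \<subseteq> words b n" "i < n"
  shows "(\<Sum>v\<in>Y. h (v i)) = (\<Sum>s\<in>{1..b}. real (card {c \<in> Y. c i = s}) * h s)"
proof -
  have "finite Y" using finite_subset[OF assms(1) finite_words] .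
  moreover have "(\<lambda>c. c i) ` Y \<subseteq> {1..b}" using assms words_D by blast
  ultimately have "(\<Sum>s\<in>{1..b}. \<Sum>v\<in>{c \<in> Y. c i = s}. h (v i)) = (\<Sum>v\<in>Y. h (v i))"
    by (intro sum.group) auto
  then show ?thesis by simp
qed

lemma freq_in_simplex:
  assumes "Y \<subseteq> words b n" "Y \<noteq> {}" "i < n"
  shows "freq b Y i \<in> simplex_on {1..b}"
proof -
  have fin: "finite Y" using finite_subset[OF assms(1) finite_words] .
  then have Y: "0 < real (card Y)" using assms(2) by (simp add: card_gt_0_iff)
  have "(\<Sum>s\<in>{1..b}. real (card {c \<in> Y. c i = s}) / real (card Y)) = 1"
    using sum_by_symbol[OF assms(1,3), of "\<lambda>_. 1"] Y by (simp flip: sum_divide_distrib)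
  moreover have "real (card {c \<in> Y. c i = s}) / real (card Y) \<le> 1" for s
    using fin Y by (simp add: card_mono)
  ultimately show ?thesis by (auto simp: simplex_on_def freq_def)
qed

text \<open>Hansel's bound summed over all \<open>m\<close>-subsets of \<open>Y\<close>. The left
  side gains the factor \<open>card Y choose m\<close>; on the right each coordinate contributes at
  most \<open>card C * card Y ^ m / fact m\<close> times \<open>phi\<close>. The quotient of the two
  factors in \<open>card Y\<close> is \<open>fall m (card Y)\<close>.\<close>

lemma hansel_subcode:
  assumes code: "is_hash_code b (Suc (Suc m)) n C" and mb: "m < b" and N: "m < card C"
    and Y: "Y \<subseteq> C" "Y \<noteq> {}" and l: "l \<le> n"
    and coll: "\<And>i X. i < l \<Longrightarrow> X \<subseteq> Y \<Longrightarrow> card X = m \<Longrightarrow> \<not> inj_on (\<lambda>c. c i) X"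
  shows "fall m (card Y) * (real (card C - m) * ln (real (card C - m))) \<le>
    ln (real (b - m)) * (real (card C) * (\<Sum>i\<in>{l..<n}. phi m {1..b} (freq b Y i) (freq b C i)))"
proof -
  define I where "I = {1..b}"
  define K where "K = card Y"
  define P where "P = {X. X \<subseteq> Y \<and> card X = m}"
  define ind where "ind i X = (if inj_on (\<lambda>c :: nat \<Rightarrow> nat. c i) X then 1 else 0 :: real)" for i X
  have CW: "C \<subseteq> words b n" using code by (simp add: is_hash_code_def)
  have "finite C" using finite_subset[OF CW finite_words] .
  then have fin: "finite C" "finite Y" using finite_subset[OF Y(1)] by auto
  have finP: "finite P" using fin by (simp add: P_def)
  have K: "0 < K" using Y fin by (simp add: K_def card_gt_0_iff)
  have C0: "C \<noteq> {}" using N by auto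
  have L: "0 \<le> ln (real (b - m))" using mb by simp
  have counts: "(\<Sum>X\<in>P. \<Sum>v\<in>C - X. ind i (insert v X)) \<le>
      real (card C) * real K ^ m / fact m * phi m I (freq b Y i) (freq b C i)" if i: "i < n" for i
  proof -
    have "(\<Sum>X\<in>P. \<Sum>v\<in>C - X. ind i (insert v X)) \<le>
       (\<Sum>X\<in>P. \<Sum>v\<in>C. if inj_on (\<lambda>c. c i) X \<and> (\<lambda>c. c i) ` X \<subseteq> I - {v i} then 1 else 0)"
    proof (rule sum_mono)
      fix X assume "X \<in> P"
      then have X: "X \<subseteq> Y" by (simp add: P_def)
      have "(\<lambda>c. c i) ` X \<subseteq> I" using X Y CW words_D i unfolding I_def by blast
      then have "(\<Sum>v\<in>C - X. ind i (insert v X)) \<le>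
         (\<Sum>v\<in>C - X. if inj_on (\<lambda>c. c i) X \<and> (\<lambda>c. c i) ` X \<subseteq> I - {v i} then 1 else 0)"
        by (intro sum_mono) (auto simp: ind_def image_iff)
      also have "\<dots> \<le> (\<Sum>v\<in>C. if inj_on (\<lambda>c. c i) X \<and> (\<lambda>c. c i) ` X \<subseteq> I - {v i} then 1 else 0)"
        using fin by (intro sum_mono2) auto
      finally show "(\<Sum>v\<in>C - X. ind i (insert v X)) \<le>
         (\<Sum>v\<in>C. if inj_on (\<lambda>c. c i) X \<and> (\<lambda>c. c i) ` X \<subseteq> I - {v i} then 1 else 0)" .
    qed
    also have "\<dots> = (\<Sum>v\<in>C. \<Sum>X\<in>P. if inj_on (\<lambda>c. c i) X \<and> (\<lambda>c. c i) ` X \<subseteq> I - {v i} then 1 else 0)"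
      by (rule sum.swap)
    also have "\<dots> = (\<Sum>v\<in>C. real (card {X. X \<subseteq> Y \<and> card X = m \<and> inj_on (\<lambda>c. c i) X \<and> (\<lambda>c. c i) ` X \<subseteq> I - {v i}}))"
    proof (rule sum.cong[OF refl])
      fix v
      have "{X. X \<subseteq> Y \<and> card X = m \<and> inj_on (\<lambda>c. c i) X \<and> (\<lambda>c. c i) ` X \<subseteq> I - {v i}} =
         {X \<in> P. inj_on (\<lambda>c. c i) X \<and> (\<lambda>c. c i) ` X \<subseteq> I - {v i}}" by (auto simp: P_def)
      then show "(\<Sum>X\<in>P. if inj_on (\<lambda>c. c i) X \<and> (\<lambda>c. c i) ` X \<subseteq> I - {v i} then 1 else 0) =
         real (card {X. X \<subseteq> Y \<and> card X = m \<and> inj_on (\<lambda>c. c i) X \<and> (\<lambda>c. c i) ` X \<subseteq> I - {v i}})"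
        by (simp add: sum.inter_filter[OF finP, symmetric])
    qed
    also have "\<dots> \<le> (\<Sum>v\<in>C. esym m (I - {v i}) (\<lambda>t. real (card {c \<in> Y. c i = t})))"
      using fin by (intro sum_mono card_transversals_le) (auto simp: I_def)
    also have "\<dots> = (\<Sum>v\<in>C. real K ^ m * esym m (I - {v i}) (freq b Y i))"
    proof (rule sum.cong[OF refl])
      fix v
      have "esym m (I - {v i}) (\<lambda>t. real (card {c \<in> Y. c i = t})) =
          esym m (I - {v i}) (\<lambda>t. real K * freq b Y i t)"
        using K by (intro esym_cong) (auto simp: I_def freq_def K_def)
      then show "esym m (I - {v i}) (\<lambda>t. real (card {c \<in> Y. c i = t})) =
          real K ^ m * esym m (I - {v i}) (freq b Y i)" by (simp add: esym_mult)
    qed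
    also have "\<dots> = (\<Sum>s\<in>I. real (card {c \<in> C. c i = s}) * (real K ^ m * esym m (I - {s}) (freq b Y i)))"
      unfolding I_def by (rule sum_by_symbol[OF CW i])
    also have "\<dots> = (\<Sum>s\<in>I. real (card C) * real K ^ m * (freq b C i s * esym m (I - {s}) (freq b Y i)))"
      using C0 fin by (intro sum.cong refl) (simp add: I_def freq_def)
    also have "\<dots> = real (card C) * real K ^ m / fact m * phi m I (freq b Y i) (freq b C i)"
      by (simp add: phi_def sum_distrib_left mult.assoc)
    finally show ?thesis .
  qed
  have "real (K choose m) * (real (card C - m) * ln (real (card C - m))) =
      (\<Sum>X\<in>P. real (card (C - X)) * ln (real (card (C - X))))"
  proof -
    have "card (C - X) = card C - m" if "X \<in> P" for X
      using that Y fin finite_subset[of X Y] by (subst card_Diff_subset) (auto simp: P_def)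
    then show ?thesis using n_subsets[OF fin(2), of m] by (simp add: P_def K_def)
  qed
  also have "\<dots> \<le> (\<Sum>X\<in>P. ln (real (b - m)) *
      (\<Sum>v\<in>C - X. real (card {i \<in> {0..<n}. inj_on (\<lambda>c. c i) (insert v X)})))"
    using Y N mb by (intro sum_mono hansel[OF code]) (auto simp: P_def)
  also have "\<dots> = ln (real (b - m)) * (\<Sum>X\<in>P. \<Sum>v\<in>C - X. \<Sum>i\<in>{l..<n}. ind i (insert v X))"
    unfolding sum_distrib_left[symmetric]
  proof (intro arg_cong[where f = "\<lambda>x. ln (real (b - m)) * x"] sum.cong refl)
    fix X v assume X: "X \<in> P"
    have "i \<in> {l..<n}" if "i \<in> {0..<n}" "inj_on (\<lambda>c. c i) (insert v X)" for i
      using that coll[of i X] X inj_on_subset[of "\<lambda>c. c i" "insert v X" X] by (fastforce simp: P_def)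
    then have "{i \<in> {0..<n}. inj_on (\<lambda>c. c i) (insert v X)} = {i \<in> {l..<n}. inj_on (\<lambda>c. c i) (insert v X)}"
      by auto
    then show "real (card {i \<in> {0..<n}. inj_on (\<lambda>c. c i) (insert v X)}) = (\<Sum>i\<in>{l..<n}. ind i (insert v X))"
      by (simp add: ind_def sum.inter_filter[symmetric])
  qed
  also have "(\<Sum>X\<in>P. \<Sum>v\<in>C - X. \<Sum>i\<in>{l..<n}. ind i (insert v X)) =
      (\<Sum>X\<in>P. \<Sum>i\<in>{l..<n}. \<Sum>v\<in>C - X. ind i (insert v X))"
    by (intro sum.cong refl sum.swap)
  also have "\<dots> = (\<Sum>i\<in>{l..<n}. \<Sum>X\<in>P. \<Sum>v\<in>C - X. ind i (insert v X))"
    by (rule sum.swap)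
  also have "\<dots> \<le> (\<Sum>i\<in>{l..<n}. real (card C) * real K ^ m / fact m * phi m I (freq b Y i) (freq b C i))"
    by (intro sum_mono counts) auto
  also have "\<dots> = real K ^ m / fact m * (real (card C) * (\<Sum>i\<in>{l..<n}. phi m I (freq b Y i) (freq b C i)))"
    by (simp add: sum_distrib_left mult_ac)
  finally have "real (K choose m) * (real (card C - m) * ln (real (card C - m))) \<le> ln (real (b - m)) *
      (real K ^ m / fact m * (real (card C) * (\<Sum>i\<in>{l..<n}. phi m I (freq b Y i) (freq b C i))))"
    using L by (simp add: mult_left_mono)
  from mult_left_mono[OF this, of "fact m / real K ^ m"] show ?thesis
    unfolding I_def[symmetric] K_def[symmetric] using K by (simp add: fall_def mult_ac)
qed

text \<open>In the proof, the subcodes \<open>sub W\<close> have at most \<open>m - 1\<close> symbols in each of the first \<open>l\<close> coordinates. Choosing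
  \<open>W\<close> with probability proportional to \<open>card (sub W)\<close> makes a random word of \<open>sub W\<close> uniform in \<open>C\<close>.\<close>
lemma (in coll_params) hash_code_average:
  assumes code: "is_hash_code b (Suc (Suc m)) n C" and N: "m < card C" and l: "l \<le> n" and m: "2 \<le> m"
  shows "(1 - real (m\<^sup>2) * (real b / real (m - 1)) ^ l / real (card C)) *
      (real (card C - m) * ln (real (card C - m))) \<le>
    ln (real (b - m)) * (real (card C) * (real (n - l) * unif_val m b))"
proof -
  define I where "I = {1..b}"
  define A where "A = {B. B \<subseteq> {1..b} \<and> card B = m - 1}"
  define Ws where "Ws = PiE {0..<l} (\<lambda>_. A)"
  define sub where "sub W = {c \<in> C. \<forall>i<l. c i \<in> W i}" for W
  define W1 where "W1 = {W \<in> Ws. sub W \<noteq> {}}"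
  \<comment> \<open>Every word of \<open>C\<close> lies in exactly \<open>R\<close> of the subcodes;
    this uniformity makes the weights \<open>w\<close> sum to 1 and the weighted frequencies average
    to those of \<open>C\<close>.\<close>
  define R where "R = (b - 1 choose (m - 2)) ^ l"
  define Q where "Q = real (card C - m) * ln (real (card C - m))"
  have CW: "C \<subseteq> words b n" using code by (simp add: is_hash_code_def)
  have fin: "finite C" using finite_subset[OF CW finite_words] .
  have fins: "finite (sub W)" "sub W \<subseteq> C" for W using fin by (auto simp: sub_def)
  have finA: "finite A" by (simp add: A_def)
  then have finW: "finite Ws" by (auto simp: Ws_def intro: finite_PiE)
  have finW1: "finite W1" using finW by (simp add: W1_def)
  have cWs: "card Ws = (b choose (m - 1)) ^ l"
    using n_subsets[of "{1..b}" "m - 1"] by (simp add: Ws_def card_PiE A_def)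
  have cR: "card {W \<in> Ws. c \<in> sub W} = R" if c: "c \<in> C" for c
  proof -
    have "{W \<in> Ws. c \<in> sub W} = PiE {0..<l} (\<lambda>i. {B \<in> A. c i \<in> B})"
    proof (rule set_eqI)
      fix W
      show "W \<in> {W \<in> Ws. c \<in> sub W} \<longleftrightarrow> W \<in> PiE {0..<l} (\<lambda>i. {B \<in> A. c i \<in> B})"
        unfolding Ws_def sub_def mem_Collect_eq PiE_iff using c by (metis atLeastLessThan_iff zero_le)
    qed
    moreover have "card {B \<in> A. c i \<in> B} = (b - 1 choose (m - 2))" if "i < l" for i
    proof -
      have ci: "c i \<in> {1..b}" using words_D[of c b n i] c CW that l by auto
      have "{B \<in> A. c i \<in> B} = insert (c i) ` {B. B \<subseteq> {1..b} - {c i} \<and> card B = m - 2}"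
      proof (intro equalityI subsetI)
        fix B assume "B \<in> {B \<in> A. c i \<in> B}"
        then have "B = insert (c i) (B - {c i})" "B - {c i} \<subseteq> {1..b} - {c i}" "card (B - {c i}) = m - 2"
          by (auto simp: A_def numeral_2_eq_2)
        then show "B \<in> insert (c i) ` {B. B \<subseteq> {1..b} - {c i} \<and> card B = m - 2}" by blast
      next
        fix B assume "B \<in> insert (c i) ` {B. B \<subseteq> {1..b} - {c i} \<and> card B = m - 2}"
        then obtain B' where B': "B = insert (c i) B'" "B' \<subseteq> {1..b} - {c i}" "card B' = m - 2" by blast
        then have "finite B'" "c i \<notin> B'" using finite_subset by auto
        then show "B \<in> {B \<in> A. c i \<in> B}" using B' ci m by (auto simp: A_def)
      qed
      moreover have "inj_on (insert (c i)) {B. B \<subseteq> {1..b} - {c i} \<and> card B = m - 2}"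
        by (auto simp: inj_on_def)
      ultimately have "card {B \<in> A. c i \<in> B} = card {B. B \<subseteq> {1..b} - {c i} \<and> card B = m - 2}"
        by (simp add: card_image)
      also have "\<dots> = (card ({1..b} - {c i}) choose (m - 2))" by (rule n_subsets) simp
      finally show ?thesis using ci by simp
    qed
    ultimately show ?thesis by (simp add: card_PiE R_def)
  qed
  have double: "(\<Sum>W\<in>W1. real (card {c \<in> sub W. P c})) = real R * real (card {c \<in> C. P c})" for P
  proof -
    have "(\<Sum>W\<in>W1. real (card {c \<in> sub W. P c})) = (\<Sum>W\<in>Ws. real (card {c \<in> sub W. P c}))"
      using finW by (intro sum.mono_neutral_left) (auto simp: W1_def)
    also have "\<dots> = (\<Sum>W\<in>Ws. \<Sum>c\<in>{c \<in> C. P c}. if c \<in> sub W then 1 else 0)"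
    proof (rule sum.cong[OF refl])
      fix W
      have "{c \<in> sub W. P c} = {c \<in> {c \<in> C. P c}. c \<in> sub W}" using fins(2) by auto
      then show "real (card {c \<in> sub W. P c}) = (\<Sum>c\<in>{c \<in> C. P c}. if c \<in> sub W then 1 else 0)"
        using fin by (simp add: sum.inter_filter[symmetric])
    qed
    also have "\<dots> = (\<Sum>c\<in>{c \<in> C. P c}. \<Sum>W\<in>Ws. if c \<in> sub W then 1 else 0)" by (rule sum.swap)
    also have "\<dots> = (\<Sum>c\<in>{c \<in> C. P c}. real R)"
    proof (rule sum.cong[OF refl])
      fix c assume "c \<in> {c \<in> C. P c}"
      then have "card {W \<in> Ws. c \<in> sub W} = R" using cR by simp
      then show "(\<Sum>W\<in>Ws. if c \<in> sub W then 1 else 0) = real R"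
        by (simp add: sum.inter_filter[OF finW, symmetric])
    qed
    finally show ?thesis by simp
  qed
  have "m - 2 \<le> b - 1" using mb by linarith
  then have Rpos: "0 < R" by (simp add: R_def)
  have Npos: "0 < real (card C)" using N by simp
  define Z where "Z = real R * real (card C)"
  have Z: "0 < Z" using Rpos Npos by (simp add: Z_def)
  define w where "w W = real (card (sub W)) / Z" for W
  have w0: "0 \<le> w W" for W using Z by (simp add: w_def)
  have w1: "sum w W1 = 1"
    using double[of "\<lambda>_. True"] Rpos Npos by (simp add: w_def Z_def flip: sum_divide_distrib)
  have cs: "0 < card (sub W)" if "W \<in> W1" for W using that fins(1) by (simp add: W1_def card_gt_0_iff)
  have Q: "0 \<le> Q" using N by (simp add: Q_def)
  have mix: "(\<Sum>W\<in>W1. w W * phi m I (freq b (sub W) i) (freq b C i)) \<le> unif_val m b" if i: "i < n" for i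
  proof (rule sum_phi_mixture_le)
    show "freq b (sub W) i \<in> simplex_on I" if "W \<in> W1" for W
      unfolding I_def using that CW fins(2) i by (intro freq_in_simplex) (auto simp: W1_def)
    show "freq b C i s = (\<Sum>W\<in>W1. w W * freq b (sub W) i s)" if "s \<in> I" for s
    proof -
      have "(\<Sum>W\<in>W1. w W * freq b (sub W) i s) = (\<Sum>W\<in>W1. real (card {c \<in> sub W. c i = s}) / Z)"
        using that cs by (intro sum.cong refl) (fastforce simp: w_def freq_def I_def)
      also have "\<dots> = real R * real (card {c \<in> C. c i = s}) / Z"
        by (simp add: double flip: sum_divide_distrib)
      also have "\<dots> = freq b C i s" using that Rpos by (simp add: Z_def freq_def I_def)
      finally show ?thesis by simp
    qed
  qed (use w0 w1 finW1 in \<open>auto simp: I_def\<close>)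
  have "1 - real (m\<^sup>2) * (real b / real (m - 1)) ^ l / real (card C) \<le>
      (\<Sum>W\<in>W1. w W * fall m (card (sub W)))"
  proof -
    \<comment> \<open>The weight cancels the size of \<open>sub W\<close>, so the total loss depends
      only on the number of subcodes.\<close>
    have "(\<Sum>W\<in>W1. w W * (real (m\<^sup>2) / real (card (sub W)))) = (\<Sum>W\<in>W1. real (m\<^sup>2) / Z)"
      using cs by (intro sum.cong refl) (simp add: w_def)
    also have "\<dots> = real (card W1) * (real (m\<^sup>2) / Z)" by simp
    also have "\<dots> \<le> real (card Ws) * (real (m\<^sup>2) / Z)"
      using finW Z by (intro mult_right_mono) (auto simp: W1_def intro: card_mono)
    also have "\<dots> = real (m\<^sup>2) * (real (card Ws) / real R) / real (card C)"
      by (simp add: Z_def)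
    also have "real (card Ws) / real R = (real b / real (m - 1)) ^ l"
    proof -
      \<comment> \<open>A random \<open>(m - 1)\<close>-subset contains a given symbol with
        probability \<open>(m - 1) / b\<close>.\<close>
      have "(m - 1) * (b choose (m - 1)) = b * (b - 1 choose (m - 2))"
        using binomial_absorption[of "m - 2" b] m by (simp add: numeral_2_eq_2 Suc_diff_Suc)
      then have "real (m - 1) * real (b choose (m - 1)) = real b * real (b - 1 choose (m - 2))"
        by (metis of_nat_mult)
      moreover have "0 < real (m - 1)" "0 < real (b - 1 choose (m - 2))" using m mb by auto
      ultimately have "real (b choose (m - 1)) / real (b - 1 choose (m - 2)) = real b / real (m - 1)"
        by (simp add: frac_eq_eq mult.commute)
      then show ?thesis by (simp add: cWs R_def flip: power_divide)
    qed
    finally have "sum w W1 - (\<Sum>W\<in>W1. w W * (real (m\<^sup>2) / real (card (sub W)))) \<ge>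
       1 - real (m\<^sup>2) * (real b / real (m - 1)) ^ l / real (card C)" using w1 by simp
    also have "sum w W1 - (\<Sum>W\<in>W1. w W * (real (m\<^sup>2) / real (card (sub W)))) =
       (\<Sum>W\<in>W1. w W * (1 - real (m\<^sup>2) / real (card (sub W))))"
      by (simp add: sum_subtractf right_diff_distrib)
    also have "\<dots> \<le> (\<Sum>W\<in>W1. w W * fall m (card (sub W)))"
      using cs w0 by (intro sum_mono mult_left_mono fall_ge) auto
    finally show ?thesis .
  qed
  then have "(1 - real (m\<^sup>2) * (real b / real (m - 1)) ^ l / real (card C)) * Q \<le>
     (\<Sum>W\<in>W1. w W * fall m (card (sub W))) * Q"
    using Q by (rule mult_right_mono)
  also have "\<dots> = (\<Sum>W\<in>W1. w W * (fall m (card (sub W)) * Q))"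
    by (simp add: sum_distrib_right mult.assoc)
  also have "\<dots> \<le> (\<Sum>W\<in>W1. w W * (ln (real (b - m)) * (real (card C) *
       (\<Sum>i\<in>{l..<n}. phi m I (freq b (sub W) i) (freq b C i)))))"
  proof (intro sum_mono mult_left_mono w0)
    fix W assume W: "W \<in> W1"
    show "fall m (card (sub W)) * Q \<le> ln (real (b - m)) * (real (card C) *
       (\<Sum>i\<in>{l..<n}. phi m I (freq b (sub W) i) (freq b C i)))"
      unfolding Q_def I_def
    proof (rule hansel_subcode[OF code mb(1) N fins(2) _ l])
      fix i X assume iX: "i < l" "X \<subseteq> sub W" "card X = m"
      have "W i \<in> A" using W iX(1) by (auto simp: W1_def Ws_def PiE_iff)
      moreover have "(\<lambda>c. c i) ` X \<subseteq> W i" using iX by (auto simp: sub_def)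
      ultimately have "card ((\<lambda>c. c i) ` X) \<le> m - 1"
        using card_mono[of "W i" "(\<lambda>c. c i) ` X"] finite_subset[of "W i" "{1..b}"] by (auto simp: A_def)
      then show "\<not> inj_on (\<lambda>c. c i) X" using card_image[of "\<lambda>c. c i" X] iX(3) m by auto
    qed (use W in \<open>auto simp: W1_def\<close>)
  qed
  also have "\<dots> = ln (real (b - m)) * (real (card C) *
     (\<Sum>W\<in>W1. \<Sum>i\<in>{l..<n}. w W * phi m I (freq b (sub W) i) (freq b C i)))"
    by (simp add: sum_distrib_left mult_ac)
  also have "(\<Sum>W\<in>W1. \<Sum>i\<in>{l..<n}. w W * phi m I (freq b (sub W) i) (freq b C i)) =
     (\<Sum>i\<in>{l..<n}. \<Sum>W\<in>W1. w W * phi m I (freq b (sub W) i) (freq b C i))"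
    by (rule sum.swap)
  also have "ln (real (b - m)) * (real (card C) * \<dots>) \<le>
     ln (real (b - m)) * (real (card C) * (\<Sum>i\<in>{l..<n}. unif_val m b))"
    using mb by (intro mult_left_mono sum_mono mix) auto
  finally show ?thesis by (simp add: Q_def)
qed

section \<open>Passage to the asymptotic rate\<close>

lemma N_hash_attained:
  assumes "0 < k"
  obtains C where "is_hash_code b k n C" "card C = N_hash b k n"
proof -
  define S where "S = {card C | C. is_hash_code b k n C}"
  have "S \<subseteq> {..card (words b n)}"
    by (auto simp: S_def is_hash_code_def intro: card_mono finite_words)
  then have "finite S" using finite_subset by blast
  \<comment> \<open>As \<open>0 < k\<close>, nothing in the empty code has to be separated, so the
    maximum is over a nonempty set.\<close>
  moreover have "is_hash_code b k n {}" using assms by (simp add: is_hash_code_def)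
  then have "S \<noteq> {}" by (auto simp: S_def)
  ultimately have "Max S \<in> S" by (rule Max_in)
  then obtain C where "is_hash_code b k n C" "card C = Max S" by (auto simp: S_def)
  then show ?thesis using that by (simp add: N_hash_def S_def)
qed

text \<open>If \<open>log 2 (card C) > t * n\<close>, take \<open>l\<close> about
  \<open>(t - \<epsilon>) * n / \<Lambda>\<close>. Then \<open>(b / (m - 1)) ^ l / card C\<close> is
  at most \<open>2 powr (- (\<epsilon> * n))\<close>, and \<open>hash_code_average\<close> divided
  by \<open>n\<close> becomes \<open>t \<le> M * (1 - (t - \<epsilon>) / \<Lambda>)\<close> in the
  limit, against \<open>lt\<close>. \<open>\<Lambda>\<close> and \<open>M\<close> leave room for
  rational bounds on the logarithms.\<close>

lemma (in coll_params) R_hash_le: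
  fixes t \<Lambda> M \<epsilon> :: real
  assumes m: "2 \<le> m" and \<Lambda>: "log 2 (real b / real (m - 1)) \<le> \<Lambda>" "0 < \<Lambda>"
    and M: "log 2 (real (b - m)) * unif_val m b \<le> M"
    and \<epsilon>: "0 < \<epsilon>" "\<epsilon> < t" "t - \<epsilon> \<le> \<Lambda>" and lt: "M * (1 - (t - \<epsilon>) / \<Lambda>) < t"
  shows "R_hash b (Suc (Suc m)) \<le> ereal t"
proof -
  define r where "r = (t - \<epsilon>) / \<Lambda>"
  have r: "0 \<le> r" "r \<le> 1" using \<epsilon> \<Lambda> by (auto simp: r_def)
  have t: "0 < t" using \<epsilon> by simp
  have "0 \<le> log 2 (real (b - m)) * unif_val m b" using mb unif_nonneg by (intro mult_nonneg_nonneg) auto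
  then have M0: "0 \<le> M" using M by simp
  \<comment> \<open>\<open>x\<close> bounds the loss from small subcodes and \<open>y\<close> the
    ratio \<open>m / card C\<close>.\<close>
  define x y where "x n = real (m\<^sup>2) * 2 powr (- (\<epsilon> * real n))" and "y n = real m * 2 powr (- (t * real n))" for n :: nat
  \<comment> \<open>The first \<open>1 / n\<close> pays for replacing \<open>N - m\<close> by
    \<open>N / 2\<close> inside the logarithm, the second for rounding \<open>l\<close>
    down.\<close>
  define h where "h n = (1 - x n) * ((1 - y n) * (t - 1 / real n)) - M * (1 - r + 1 / real n)" for n :: nat
  have powr0: "(\<lambda>n. 2 powr (- (c * real n))) \<longlonglongrightarrow> 0" if "0 < c" for c :: real
  proof -
    have "2 powr (- (c * real n)) = (2 powr (- c)) ^ n" for n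
      by (simp add: powr_realpow[symmetric] powr_powr)
    moreover have "(\<lambda>n. (2 powr (- c)) ^ n) \<longlonglongrightarrow> 0"
      using that by (intro LIMSEQ_realpow_zero) (auto simp: powr_less_one)
    ultimately show ?thesis by simp
  qed
  have x0: "x \<longlonglongrightarrow> 0"
    using tendsto_mult_left[OF powr0[OF \<epsilon>(1)], of "real (m\<^sup>2)"] by (simp add: x_def[abs_def])
  have y0: "y \<longlonglongrightarrow> 0"
    using tendsto_mult_left[OF powr0[OF t], of "real m"] by (simp add: y_def[abs_def])
  have n0: "(\<lambda>n. 1 / real n) \<longlonglongrightarrow> 0" by (rule lim_1_over_n)
  have "h \<longlonglongrightarrow> (1 - 0) * ((1 - 0) * (t - 0)) - M * (1 - r + 0)"
    unfolding h_def by (intro tendsto_intros x0 y0 n0)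
  moreover have "0 < (1 - 0) * ((1 - 0) * (t - 0)) - M * (1 - r + 0)" using lt by (simp add: r_def)
  ultimately have ev_h: "eventually (\<lambda>n. 0 < h n) sequentially" by (rule order_tendstoD)
  have ev_x: "eventually (\<lambda>n. x n < 1) sequentially" using x0 by (rule order_tendstoD) simp
  have ev_y: "eventually (\<lambda>n. y n < 1 / 2) sequentially" using y0 by (rule order_tendstoD) simp
  have ev_n: "eventually (\<lambda>n. 1 / real n < t) sequentially" using n0 t by (rule order_tendstoD)
  have "eventually (\<lambda>n. ereal (log 2 (real (N_hash b (Suc (Suc m)) n)) / real n) \<le> ereal t) sequentially"
    using ev_h ev_x ev_y ev_n eventually_gt_at_top[of 0]
  proof eventually_elim
    case (elim n)
    obtain C where C: "is_hash_code b (Suc (Suc m)) n C" "card C = N_hash b (Suc (Suc m)) n"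
      using N_hash_attained[of "Suc (Suc m)"] by blast
    define N where "N = real (card C)"
    have n: "0 < real n" using elim by simp
    have "log 2 N \<le> t * real n"
    proof (rule ccontr)
      assume "\<not> log 2 N \<le> t * real n"
      then have big: "t * real n < log 2 N" by simp
      moreover have "0 < t * real n" using t n by simp
      ultimately have "N \<noteq> 0" by (auto simp: log_def)
      then have N0: "0 < N" by (simp add: N_def)
      then have pN: "2 powr (t * real n) < N" using big by (simp add: less_log_iff)
      have "real m / N \<le> real m / 2 powr (t * real n)"
        using pN N0 by (intro divide_left_mono) auto
      then have mN: "real m / N \<le> y n" by (simp add: y_def powr_minus divide_inverse)
      then have "real m / N < 1 / 2" using elim by linarith
      then have mN2: "real m < N / 2" using N0 by (simp add: field_simps)
      then have mC: "m < card C" using N0 by (simp add: N_def)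
      have Nm: "real (card C - m) = N - real m" using mC by (simp add: N_def of_nat_diff)
      define l where "l = nat \<lfloor>r * real n\<rfloor>"
      have l1: "real l \<le> r * real n" "r * real n - 1 \<le> real l"
        using r n by (auto simp: l_def)
      have "r * real n \<le> real n" using r n by simp
      then have l: "l \<le> n" using l1 by linarith
      define B where "B = real b / real (m - 1)"
      have B: "0 < B" using m mb by (simp add: B_def)
      have "B ^ l = 2 powr (real l * log 2 B)"
      proof -
        have "2 powr (real l * log 2 B) = (2 powr log 2 B) powr real l"
          by (simp only: powr_powr mult.commute)
        then show ?thesis using B by (simp add: powr_realpow)
      qed
      also have "\<dots> \<le> 2 powr ((t - \<epsilon>) * real n)"
      proof (rule powr_mono)
        have "real l * log 2 B \<le> real l * \<Lambda>" using \<Lambda> by (intro mult_left_mono) (auto simp: B_def)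
        also have "\<dots> \<le> r * real n * \<Lambda>" using l1 \<Lambda> by (intro mult_right_mono) auto
        also have "\<dots> = (t - \<epsilon>) * real n" using \<Lambda> by (simp add: r_def)
        finally show "real l * log 2 B \<le> (t - \<epsilon>) * real n" .
      qed simp
      finally have "B ^ l / N \<le> 2 powr ((t - \<epsilon>) * real n) / 2 powr (t * real n)"
        using pN B N0 by (intro frac_le) auto
      also have "\<dots> = 2 powr (- (\<epsilon> * real n))"
        by (simp add: powr_diff[symmetric] algebra_simps)
      finally have "real (m\<^sup>2) * (B ^ l / N) \<le> x n"
        unfolding x_def by (intro mult_left_mono) auto
      then have X: "real (m\<^sup>2) * B ^ l / N \<le> x n" by simp
      have "t * real n - 1 \<le> log 2 (N / 2)"
        using big N0 by (simp add: log_divide)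
      also have "\<dots> \<le> log 2 (N - real m)" using mN2 N0 by (simp add: log_le_cancel_iff)
      finally have lg: "t * real n - 1 \<le> log 2 (N - real m)" .
      have tn: "0 \<le> t * real n - 1" using elim n by (simp add: field_simps)
      define P where "P = (1 - real (m\<^sup>2) * B ^ l / N) * ((1 - real m / N) * log 2 (N - real m))"
      have "(1 - x n) * ((1 - y n) * (t * real n - 1)) \<le> P"
        unfolding P_def using X mN lg tn elim by (intro mult_mono) auto
      also have "P \<le> log 2 (real (b - m)) * unif_val m b * real (n - l)"
      proof (rule mult_right_le_imp_le)
        have "P * (N * ln 2) = (1 - real (m\<^sup>2) * B ^ l / N) * ((N - real m) * ln (N - real m))"
          using N0 by (simp add: P_def log_def field_simps)
        also have "\<dots> \<le> ln (real (b - m)) * (N * (real (n - l) * unif_val m b))"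
          using hash_code_average[OF C(1) mC l m] by (simp add: Nm B_def N_def)
        also have "\<dots> = log 2 (real (b - m)) * unif_val m b * real (n - l) * (N * ln 2)"
          by (simp add: log_def)
        finally show "P * (N * ln 2) \<le> log 2 (real (b - m)) * unif_val m b * real (n - l) * (N * ln 2)" .
      qed (use N0 in simp)
      also have "\<dots> \<le> M * real (n - l)" using M by (intro mult_right_mono) auto
      also have "\<dots> \<le> M * (real n - r * real n + 1)"
        using M0 l l1 by (intro mult_left_mono) (auto simp: of_nat_diff)
      finally have "(1 - x n) * ((1 - y n) * (t * real n - 1)) \<le> M * (real n - r * real n + 1)" .
      moreover have "real n * h n =
          (1 - x n) * ((1 - y n) * (real n * (t - 1 / real n))) - M * (real n * (1 - r + 1 / real n))"
      proof -
        define u where "u = 1 / real n"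
        show ?thesis unfolding h_def u_def[symmetric] by (simp add: algebra_simps)
      qed
      moreover have "real n * (t - 1 / real n) = t * real n - 1"
        "real n * (1 - r + 1 / real n) = real n - r * real n + 1"
        using n by (simp_all add: algebra_simps)
      ultimately have "real n * h n \<le> 0" by simp
      then show False using elim n by (simp add: mult_le_0_iff)
    qed
    then have "log 2 N / real n \<le> t" using n by (simp add: divide_le_eq)
    then show ?case using C(2) by (simp add: N_def)
  qed
  then show ?thesis unfolding R_hash_def by (rule Limsup_bounded)
qed

lemma log2_le_ratio:
  assumes "0 < x" "0 < q" "x ^ q \<le> 2 ^ p"
  shows "log 2 x \<le> real p / real q"
proof -
  have "real q * log 2 x = log 2 (x ^ q)" using assms by (simp add: log_nat_power)
  also have "\<dots> \<le> log 2 (2 ^ p)" using assms by (subst log_le_cancel_iff) auto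
  also have "\<dots> = real p" by (simp add: log_nat_power)
  finally show ?thesis using assms by (simp add: field_simps)
qed

theorem theorem1:
  shows "R_hash 7 7 \<le> ereal 0.0408975 \<and> R_hash 8 8 \<le> ereal 0.0188887 \<and>
         R_hash 9 8 \<le> ereal 0.0561537 \<and> R_hash 10 9 \<le> ereal 0.0277279 \<and>
         R_hash 11 10 \<le> ereal 0.0132033"
proof (intro conjI)
  \<comment> \<open>\<open>b - m\<close> is 2 in the first two cases and 3 in the others. Each
    \<open>\<Lambda>\<close> is a rational upper bound for \<open>log 2 (b / (m - 1))\<close>; the
    pair (9, 8) leaves the least room, hence the denominators 200 and 33.\<close>
  have log3: "log 2 3 \<le> 317 / 200" using log2_le_ratio[of 3 200 317] by simp
  have "log 2 (7 / 4) \<le> 5 / 6" using log2_le_ratio[of "7 / 4" 6 5] by (simp add: power_divide)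
  then show "R_hash 7 7 \<le> ereal 0.0408975"
    using coll_params.R_hash_le[OF coll_params_7_7, where t = "0.0408975" and \<Lambda> = "5 / 6"
      and M = "unif_val 5 7" and \<epsilon> = "1 / 10 ^ 6"]
    by (simp add: unif_values)
  have "log 2 (8 / 5) \<le> 1" using log2_le_ratio[of "8 / 5" 1 1] by simp
  then show "R_hash 8 8 \<le> ereal 0.0188887"
    using coll_params.R_hash_le[OF coll_params_8_8, where t = "0.0188887" and \<Lambda> = 1
      and M = "unif_val 6 8" and \<epsilon> = "1 / 10 ^ 6"]
    by (simp add: unif_values)
  have "log 2 (9 / 5) \<le> 28 / 33" using log2_le_ratio[of "9 / 5" 33 28] by (simp add: power_divide)
  then show "R_hash 9 8 \<le> ereal 0.0561537"
    using coll_params.R_hash_le[OF coll_params_9_8, where t = "0.0561537" and \<Lambda> = "28 / 33"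
      and M = "317 / 200 * unif_val 6 9" and \<epsilon> = "1 / 10 ^ 6"] log3
    by (simp add: unif_values)
  have "log 2 (10 / 6) \<le> 3 / 4" using log2_le_ratio[of "10 / 6" 4 3] by (simp add: power_divide)
  then show "R_hash 10 9 \<le> ereal 0.0277279"
    using coll_params.R_hash_le[OF coll_params_10_9, where t = "0.0277279" and \<Lambda> = "3 / 4"
      and M = "317 / 200 * unif_val 7 10" and \<epsilon> = "1 / 10 ^ 6"] log3
    by (simp add: unif_values)
  have "log 2 (11 / 7) \<le> 2 / 3" using log2_le_ratio[of "11 / 7" 3 2] by (simp add: power_divide)
  then show "R_hash 11 10 \<le> ereal 0.0132033"
    using coll_params.R_hash_le[OF coll_params_11_10, where t = "0.0132033" and \<Lambda> = "2 / 3"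
      and M = "317 / 200 * unif_val 8 11" and \<epsilon> = "1 / 10 ^ 6"] log3
    by (simp add: unif_values)
qed

end
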